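(* Let $M$ and $\alpha$ be real numbers satisfying $$\frac13(M+2)<\alpha\le\frac25(M-10),$$ and let $W_\infty$ and $\rho_\infty$ be the potential and the probability measure defined in the context. Then there is a constant $c_\infty$ such that $$(W_\infty*\rho_\infty)(x)=c_\infty\ \ \forall x\in\operatorname{supp}\rho_\infty,\qquad (W_\infty*\rho_\infty)(x)>c_\infty\ \ \forall x\notin\operatorname{supp}\rho_\infty.$$ Also, $W_\infty*\rho_\infty\in C^{1,\gamma}_{loc}$ for some $\gamma>0$. Therefore, $W_\infty'*\rho_\infty$ is defined pointwise and satisfies $W_\infty'*\rho_\infty=0$ on $\operatorname{supp}\rho_\infty$, i.e. $\rho_\infty$ is a steady state for the interaction energy associated to the potential $W_\infty$.
   Context: Cantor measure: define closed intervals $I_{k,l}$, $k\ge0$, $0\le l\le2^k-1$, by $I_{0,0}=[0,1]$, $I_{k+1,2l}=I_{k,l}^{\mathrm{left}}$, $I_{k+1,2l+1}=I_{k,l}^{\mathrm{right}}$, where for $I=[x_1,x_2]$, $I^{\mathrm{left}}=[x_1,x_1+\frac{x_2-x_1}{M}]$, $I^{\mathrm{right}}=[x_2-\frac{x_2-x_1}{M},x_2]$. Let $\rho_k=(\frac M2)^k\sum_{l=0}^{2^k-1}\chi_{I_{k,l}}$, and let $\rho_\infty$ be the weak limit of $\rho_k$ as $k\to\infty$: the uniform distribution on the Cantor set $S=\bigcap_k\bigcup_lI_{k,l}$. Potentials: for $k\ge1$, $W_k:\mathbb{R}\to\mathbb{R}$ is the even potential (defined up to an additive constant) with $$W_k'(x)=\frac{M}{2M-4}(-1+2x)+\omega_k(x),\quad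 x>0,$$ where $\omega_k$ is the odd continuous piecewise linear function given for $x>0$ by $$\omega_k(x)=\begin{cases}0,&0<x\le(M-\alpha)M^{-k},\\ \big(-\frac32+\frac34\cdot\frac{2}{\alpha-2}(M-2)\big)-\frac34\cdot\frac{2}{\alpha-2}M^kx,&(M-\alpha)M^{-k}\le x\le(M-2)M^{-k},\\ -(M-\frac12)+M^jx,&(M-2)M^{-j}\le x\le M^{1-j},\ j=1,\dots,k,\\ \frac12,&M^{-j}\le x\le(M-\alpha)M^{-j},\ j=1,\dots,k-1,\\ \big(-\frac32+\frac{2}{\alpha-2}(M-2)\big)-\frac{2}{\alpha-2}M^jx,&(M-\alpha)M^{-j}\le x\le(M-2)M^{-j},\ j=1,\dots,k-1,\\ \frac12,&x\ge1.\end{cases}$$ The limiting potential $W_\infty$ is the even (locally Lipschitz) function, defined up to an additive constant, with $W_\infty'(x)=\lim_{k\to\infty}W_k'(x)$ for all $x\ne0$. Steady state of the interaction energy with potential $W$: $0\in\partial V(x)$ for $\rho$-a.e. $x$, where $V=W*\rho$ and $\partial V$ is its subdifferential ($V'=0$ on $\operatorname{supp}\rho$ if $V\in C^1$). *)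

theory Defs
  imports "HOL-Probability.Probability"
begin

section \<open>Cantor measure\<close>

text \<open>An interval is encoded by the pair of its endpoints; \<open>cantor_int M k l\<close> is $I_{k,l}$.\<close>

fun left_part :: "real \<Rightarrow> real \<times> real \<Rightarrow> real \<times> real" where
  "left_part M (x1, x2) = (x1, x1 + (x2 - x1) / M)"

fun right_part :: "real \<Rightarrow> real \<times> real \<Rightarrow> real \<times> real" where
  "right_part M (x1, x2) = (x2 - (x2 - x1) / M, x2)"

fun cantor_int :: "real \<Rightarrow> nat \<Rightarrow> nat \<Rightarrow> real \<times> real" where
  "cantor_int M 0 l = (0, 1)"
| "cantor_int M (Suc k) l =
     (if even l then left_part M (cantor_int M k (l div 2))
      else right_part M (cantor_int M k (l div 2)))"

definition cantor_density :: "real \<Rightarrow> nat \<Rightarrow> real \<Rightarrow> real" where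
  "cantor_density M k x =
     (M / 2) ^ k * (\<Sum>l<2^k. indicator {fst (cantor_int M k l)..snd (cantor_int M k l)} x)"

definition cantor_approx :: "real \<Rightarrow> nat \<Rightarrow> real measure" where
  "cantor_approx M k = density lborel (\<lambda>x. ennreal (cantor_density M k x))"

definition is_cantor_measure :: "real \<Rightarrow> real measure \<Rightarrow> bool" where
  "is_cantor_measure M \<rho> \<longleftrightarrow> real_distribution \<rho> \<and> weak_conv_m (cantor_approx M) \<rho>"

section \<open>Potentials\<close>

text \<open>
  For $0 < x \le 1$ let $j$ be the unique index with $M^{-j} < x \le M^{1-j}$; it is the least $j$
  with $M^{-j} < x$, and it is $0$ for $x > 1$.  The pieces of $\omega_k$ are grouped by this index.
  The coefficient $c$ is $3/4$ on the innermost slope ($j = k$) and $1$ on the others, and the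
  plateau before the slope is at height $0$ or $1/2$ accordingly.  The facts
  \<open>omega_inner\<close> to \<open>omega_outer\<close> below give the piecewise formula on the closed intervals.
\<close>

definition omega_pos :: "real \<Rightarrow> real \<Rightarrow> nat \<Rightarrow> real \<Rightarrow> real" where
  "omega_pos M \<alpha> k x =
     (let j = (LEAST j. 1 / M ^ j < x); c = (if j = k then 3/4 else 1) in
      if j = 0 then 1/2
      else if j > k then 0
      else if x \<le> (M - \<alpha>) / M ^ j then (if j = k then 0 else 1/2)
      else if x \<le> (M - 2) / M ^ j
        then (- 3/2 + c * (2 / (\<alpha> - 2)) * (M - 2)) - c * (2 / (\<alpha> - 2)) * M ^ j * x
      else - (M - 1/2) + M ^ j * x)"

definition omega :: "real \<Rightarrow> real \<Rightarrow> nat \<Rightarrow> real \<Rightarrow> real" where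
  "omega M \<alpha> k x = sgn x * omega_pos M \<alpha> k \<bar>x\<bar>"

lemma omega_odd: "omega M \<alpha> k (- x) = - omega M \<alpha> k x"
  by (simp add: omega_def sgn_minus)

lemma layer_eq:
  fixes M x :: real
  assumes "1 < M" "1 \<le> j" "1 / M ^ j < x" "x \<le> M / M ^ j"
  shows "(LEAST j. 1 / M ^ j < x) = j"
proof (rule Least_equality)
  fix i assume i: "1 / M ^ i < x"
  show "j \<le> i"
  proof (rule ccontr)
    assume "\<not> j \<le> i"
    then have "M ^ Suc i \<le> M ^ j"
      using assms by (intro power_increasing) auto
    then have "M / M ^ j \<le> M / M ^ Suc i"
      using assms by (intro divide_left_mono) auto
    also have "\<dots> = 1 / M ^ i" using assms by simp
    finally show False using i assms by simp
  qed
qed (use assms in simp)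

lemma layer_gt:
  fixes M x :: real
  assumes "1 < M" "0 < x" "x \<le> 1 / M ^ k"
  shows "k < (LEAST j. 1 / M ^ j < x)"
proof -
  obtain n where "1 / x < M ^ n" using real_arch_pow[OF assms(1)] by blast
  then have "1 / M ^ n < x" using assms by (simp add: field_simps)
  then have L: "1 / M ^ (LEAST j. 1 / M ^ j < x) < x" by (rule LeastI)
  show ?thesis
  proof (rule ccontr)
    assume "\<not> k < (LEAST j. 1 / M ^ j < x)"
    then have "M ^ (LEAST j. 1 / M ^ j < x) \<le> M ^ k"
      using assms by (intro power_increasing) auto
    then have "1 / M ^ k \<le> 1 / M ^ (LEAST j. 1 / M ^ j < x)"
      using assms by (intro divide_left_mono) auto
    then show False using L assms by simp
  qed
qed

lemma layer_zero:
  fixes M x :: real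
  assumes "1 < x"
  shows "(LEAST j. 1 / M ^ j < x) = 0"
  using assms by (intro Least_equality) auto

context
  fixes M \<alpha> :: real and k :: nat
  assumes \<alpha>: "2 < \<alpha>" "\<alpha> < M - 1" and k: "1 \<le> k"
begin

lemma omega_inner:
  assumes "0 < x" "x \<le> (M - \<alpha>) / M ^ k"
  shows "omega M \<alpha> k x = 0"
proof (cases "x \<le> 1 / M ^ k")
  case True
  then show ?thesis using layer_gt[of M x k] \<alpha> assms by (simp add: omega_def omega_pos_def Let_def)
next
  case False
  have "(M - \<alpha>) / M ^ k \<le> M / M ^ k" using \<alpha> by (intro divide_right_mono) auto
  then have "(LEAST j. 1 / M ^ j < x) = k"
    using False assms \<alpha> k by (intro layer_eq) auto
  then show ?thesis using assms k by (simp add: omega_def omega_pos_def Let_def)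
qed

lemma slope_layer:
  assumes "1 \<le> j" "(M - \<alpha>) / M ^ j \<le> x" "x \<le> M / M ^ j"
  shows "(LEAST j. 1 / M ^ j < x) = j" "0 < x"
proof -
  have "1 / M ^ j < (M - \<alpha>) / M ^ j" using \<alpha> by (intro divide_strict_right_mono) auto
  then show "(LEAST j. 1 / M ^ j < x) = j" using assms \<alpha> by (intro layer_eq) auto
  have "0 < 1 / M ^ j" using \<alpha> by simp
  then show "0 < x" using \<open>1 / M ^ j < (M - \<alpha>) / M ^ j\<close> assms(2) by linarith
qed

lemma slope_drop: "c * (2 / (\<alpha> - 2)) * (M - 2) - c * (2 / (\<alpha> - 2)) * (M - \<alpha>) = 2 * c"
proof -
  have "c * (2 / (\<alpha> - 2)) * (M - 2) - c * (2 / (\<alpha> - 2)) * (M - \<alpha>)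
      = c * (2 / (\<alpha> - 2)) * (\<alpha> - 2)" by (simp only: right_diff_distrib)
  then show ?thesis using \<alpha> by simp
qed

lemma omega_slope_inner:
  assumes "(M - \<alpha>) / M ^ k \<le> x" "x \<le> (M - 2) / M ^ k"
  shows "omega M \<alpha> k x =
    (- 3/2 + 3/4 * (2 / (\<alpha> - 2)) * (M - 2)) - 3/4 * (2 / (\<alpha> - 2)) * M ^ k * x"
proof -
  have "(M - 2) / M ^ k \<le> M / M ^ k" using \<alpha> by (intro divide_right_mono) auto
  then have L: "(LEAST j. 1 / M ^ j < x) = k" "0 < x" using slope_layer[of k x] assms k by auto
  show ?thesis
  proof (cases "x \<le> (M - \<alpha>) / M ^ k")
    case True
    then have "x = (M - \<alpha>) / M ^ k" using assms by simp
    then have "M ^ k * x = M - \<alpha>" using \<alpha> by simp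
    then have "3/4 * (2 / (\<alpha> - 2)) * M ^ k * x = 3/4 * (2 / (\<alpha> - 2)) * (M - \<alpha>)"
      by (simp only: mult.assoc)
    moreover have "omega M \<alpha> k x = 0" using omega_inner L True by blast
    ultimately show ?thesis using slope_drop[of "3/4"] by linarith
  next
    case False
    then show ?thesis using assms L k by (simp add: omega_def omega_pos_def Let_def)
  qed
qed

lemma omega_rise:
  assumes "1 \<le> j" "j \<le> k" "(M - 2) / M ^ j \<le> x" "x \<le> M / M ^ j"
  shows "omega M \<alpha> k x = - (M - 1/2) + M ^ j * x"
proof -
  have lt: "(M - \<alpha>) / M ^ j < (M - 2) / M ^ j"
    using \<alpha> by (intro divide_strict_right_mono) auto
  then have L: "(LEAST j. 1 / M ^ j < x) = j" "0 < x" using slope_layer[of j x] assms by auto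
  show ?thesis
  proof (cases "x \<le> (M - 2) / M ^ j")
    case True
    then have x: "x = (M - 2) / M ^ j" using assms by simp
    then have "M ^ j * x = M - 2" using \<alpha> by simp
    then have "c * (2 / (\<alpha> - 2)) * M ^ j * x = c * (2 / (\<alpha> - 2)) * (M - 2)" for c
      by (simp only: mult.assoc)
    moreover define c :: real where "c = (if j = k then 3/4 else 1)"
    have "\<not> x \<le> (M - \<alpha>) / M ^ j" using lt x by simp
    then have "omega M \<alpha> k x =
        (- 3/2 + c * (2 / (\<alpha> - 2)) * (M - 2)) - c * (2 / (\<alpha> - 2)) * M ^ j * x"
      using True L assms(1,2) by (simp add: omega_def omega_pos_def Let_def c_def)
    ultimately show ?thesis using \<open>M ^ j * x = M - 2\<close> by simp
  next
    case False
    then show ?thesis using assms L lt by (simp add: omega_def omega_pos_def Let_def)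
  qed
qed

lemma omega_plateau:
  assumes "1 \<le> j" "j < k" "1 / M ^ j \<le> x" "x \<le> (M - \<alpha>) / M ^ j"
  shows "omega M \<alpha> k x = 1/2"
proof (cases "x = 1 / M ^ j")
  case True
  have "x = M / M ^ Suc j" using True \<alpha> by simp
  moreover have "(M - 2) / M ^ Suc j \<le> M / M ^ Suc j" using \<alpha> by (intro divide_right_mono) auto
  ultimately have "omega M \<alpha> k x = - (M - 1/2) + M ^ Suc j * x"
    using assms by (intro omega_rise) auto
  then show ?thesis using \<alpha> True by simp
next
  case False
  have "(M - \<alpha>) / M ^ j \<le> M / M ^ j" using \<alpha> by (intro divide_right_mono) auto
  then have L: "(LEAST j. 1 / M ^ j < x) = j"
    using False assms \<alpha> by (intro layer_eq) auto
  have "0 < 1 / M ^ j" using \<alpha> by simp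
  then have "0 < x" using assms(3) by (rule less_le_trans)
  then show ?thesis using L assms by (simp add: omega_def omega_pos_def Let_def)
qed

lemma omega_slope:
  assumes "1 \<le> j" "j < k" "(M - \<alpha>) / M ^ j \<le> x" "x \<le> (M - 2) / M ^ j"
  shows "omega M \<alpha> k x =
    (- 3/2 + 2 / (\<alpha> - 2) * (M - 2)) - 2 / (\<alpha> - 2) * M ^ j * x"
proof -
  have "(M - 2) / M ^ j \<le> M / M ^ j" using \<alpha> by (intro divide_right_mono) auto
  then have L: "(LEAST j. 1 / M ^ j < x) = j" "0 < x" using slope_layer[of j x] assms by auto
  show ?thesis
  proof (cases "x \<le> (M - \<alpha>) / M ^ j")
    case True
    then have x: "x = (M - \<alpha>) / M ^ j" using assms by simp
    then have "M ^ j * x = M - \<alpha>" using \<alpha> by simp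
    then have "2 / (\<alpha> - 2) * M ^ j * x = 2 / (\<alpha> - 2) * (M - \<alpha>)"
      by (simp only: mult.assoc)
    moreover have "omega M \<alpha> k x = 1/2" using L True assms(1,2)
      by (simp add: omega_def omega_pos_def Let_def)
    ultimately show ?thesis using slope_drop[of 1] unfolding mult_1_left by linarith
  next
    case False
    then show ?thesis using assms L by (simp add: omega_def omega_pos_def Let_def)
  qed
qed

lemma omega_outer:
  assumes "1 \<le> x"
  shows "omega M \<alpha> k x = 1/2"
proof (cases "x = 1")
  case True
  then have "omega M \<alpha> k x = - (M - 1/2) + M ^ 1 * x"
    using \<alpha> k by (intro omega_rise) (auto simp: divide_simps)
  then show ?thesis using True by simp
next
  case False
  then show ?thesis using assms layer_zero[of x M]
    by (simp add: omega_def omega_pos_def Let_def)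
qed

end

text \<open>
  The derivative $W_k'$ away from $0$, extended from $x > 0$ to $x < 0$ as an odd function
  because $W_k$ is even.
\<close>

definition W_deriv :: "real \<Rightarrow> real \<Rightarrow> nat \<Rightarrow> real \<Rightarrow> real" where
  "W_deriv M \<alpha> k x = sgn x * (M / (2 * M - 4) * (- 1 + 2 * \<bar>x\<bar>)) + omega M \<alpha> k x"

definition locally_lipschitz :: "(real \<Rightarrow> real) \<Rightarrow> bool" where
  "locally_lipschitz f \<longleftrightarrow> (\<forall>x. \<exists>r>0. \<exists>L. L-lipschitz_on (ball x r) f)"

text \<open>
  $W_\infty$ is determined only up to an additive constant, so it is described by a predicate;
  nothing is required of $W_\infty'$ at $0$.
\<close>

definition is_limit_potential :: "real \<Rightarrow> real \<Rightarrow> (real \<Rightarrow> real) \<Rightarrow> bool" where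
  "is_limit_potential M \<alpha> W \<longleftrightarrow>
     (\<forall>x. W (- x) = W x) \<and>
     locally_lipschitz W \<and>
     (\<forall>x. x \<noteq> 0 \<longrightarrow>
        (\<exists>D. (W has_real_derivative D) (at x) \<and> (\<lambda>k. W_deriv M \<alpha> k x) \<longlonglongrightarrow> D))"

section \<open>Convolution, support, regularity, steady states\<close>

definition conv :: "(real \<Rightarrow> real) \<Rightarrow> real measure \<Rightarrow> real \<Rightarrow> real" where
  "conv f \<rho> x = (LINT y|\<rho>. f (x - y))"

definition msupp :: "real measure \<Rightarrow> real set" where
  "msupp \<rho> = {x. \<forall>U. open U \<and> x \<in> U \<longrightarrow> 0 < emeasure \<rho> U}"

definition C1_holder_loc :: "real \<Rightarrow> (real \<Rightarrow> real) \<Rightarrow> bool" where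
  "C1_holder_loc \<gamma> f \<longleftrightarrow>
     (\<forall>x. f field_differentiable (at x)) \<and>
     (\<forall>K. compact K \<longrightarrow>
        (\<exists>C. \<forall>x\<in>K. \<forall>y\<in>K. \<bar>deriv f x - deriv f y\<bar> \<le> C * \<bar>x - y\<bar> powr \<gamma>))"

text \<open>
  The Frechet subdifferential: $V(y) \ge V(x) + \xi (y - x) + o(|y - x|)$ as $y \to x$.
  It is $\{V'(x)\}$ where $V$ is differentiable, without convexity of $V$.
\<close>

definition subdifferential :: "(real \<Rightarrow> real) \<Rightarrow> real \<Rightarrow> real set" where
  "subdifferential V x =
     {\<xi>. \<forall>\<epsilon>>0. \<forall>\<^sub>F y in at x. V y \<ge> V x + \<xi> * (y - x) - \<epsilon> * \<bar>y - x\<bar>}"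

definition steady_state :: "(real \<Rightarrow> real) \<Rightarrow> real measure \<Rightarrow> bool" where
  "steady_state W \<rho> \<longleftrightarrow> (AE x in \<rho>. 0 \<in> subdifferential (conv W \<rho>) x)"

end

theory Submission
  imports Defs
begin

text \<open>
  Write \<open>V = conv W \<rho>\<close> and \<open>\<epsilon> = 2 / (\<alpha> - 2)\<close>.  Everything rests on self-similarity.  The measure is
  the average of its images under \<open>y \<mapsto> y / M\<close> and \<open>y \<mapsto> (M - 1 + y) / M\<close> (\<open>integral_self_similar\<close>), and
  the profile \<open>\<omega>\<close> of the limiting force satisfies \<open>\<omega>(t / M) = \<omega>(t)\<close> for \<open>0 < t \<le> M - \<alpha>\<close>, while on
  \<open>[1 - 2 / M, 1]\<close> it is affine with slope \<open>M\<close>.  For \<open>z \<in> [0, 1]\<close> split \<open>V'(z / M)\<close> into the contributions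
  of the two halves of the measure.  The left half contributes a copy of \<open>V'(z)\<close> up to a linear term;
  the right half sees only the affine piece of \<open>\<omega>\<close>, so it contributes a linear function of \<open>z\<close>.  The coefficient
  \<open>M / (2 M - 4)\<close> of the quadratic part of \<open>W\<close> is exactly the one for which the linear terms cancel, and
  \<open>V'(z / M) = V'(z) / 2\<close> (\<open>V'_scale\<close>).  Integration gives
  \<open>V(z / M) - V(0) = (V(z) - V(0)) / (2 M)\<close> (\<open>excess_scale\<close>), and since \<open>V\<close> is symmetric about \<open>1/2\<close>,
  both laws also hold for the other map.  A point of the support has preimages of every order in the support, so
  \<open>V'\<close> and \<open>V - V(0)\<close> are bounded there by a constant times \<open>2\<^sup>-\<^sup>k\<close> for every \<open>k\<close>: both vanish.

  The same scaling law carries the strict inequality \<open>V > V(0)\<close> from the central gap \<open>(1 / M, 1 - 1 / M)\<close> to every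
  gap of the Cantor set, so that only the central gap and the outside of \<open>[0, 1]\<close> need estimates.
  These two are linked.  With \<open>overlap z = E[max 0 (z + y - 1)]\<close>, where \<open>y\<close> has law \<open>\<rho>\<close>, one has for \<open>z \<in> [0, 1]\<close>
  \<open>-V'(-z / M) = (-V'(-z) - overlap z) / 2\<close> (\<open>outer_scale\<close>) and
  \<open>V'((1 + z) / M) = (-V'(-z) - (1 + \<epsilon>) overlap z) / 2\<close> (\<open>V'_gap_left\<close>).
  The derivative itself does not keep one sign in the left half of the gap; therefore the inequality is
  proved for the integrated quantity
  \<open>margin z = V(-z) - V(0) - (1 + \<epsilon>) \<integral>\<^sub>0\<^sup>z overlap\<close>.  Positivity of the margin on \<open>[1 / M, 1]\<close> follows from
  crude bounds on \<open>\<omega>\<close>: the condition \<open>\<alpha> \<le> 2/5 * (M - 10)\<close> makes \<open>\<omega> = 1/2\<close> on all of \<open>[1 / M, 3/5 + 1 / M]\<close>.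
  It descends to \<open>(0, 1]\<close> because \<open>margin (z / M) \<ge> margin z / (2 M)\<close> (\<open>margin_scale_ge\<close>).
  This settles the outside and the part \<open>(1 / M, 2 / M]\<close> of the gap.  On \<open>[2 / M, 1/2]\<close> a piecewise
  quadratic minorant of \<open>V - V(0)\<close> can only fail at the midpoint, where it is positive because
  \<open>\<alpha> > (M + 2) / 3\<close> (\<open>excess_pos_middle\<close>).

  For the Hoelder bound, an interval of length \<open>r\<close> has measure at most a constant times \<open>r powr (ln 2 / ln M)\<close>, while
  the force is Lipschitz with constant of order \<open>1 / \<delta>\<close> at distance \<open>\<delta>\<close> from its singularity at \<open>0\<close>.  Comparing
  \<open>V'\<close> at two points at distance \<open>h\<close> with the cut-off \<open>\<delta> = sqrt h\<close> gives the exponent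
  \<open>ln 2 / (2 ln M)\<close>.
\<close>

section \<open>Self-similarity of the approximating densities\<close>

text \<open>
  The intervals are defined by refining the last binary digit of the index, whereas self-similarity
  concerns the first one.  The two agree because affine maps commute with taking the left and right parts.
\<close>

lemma cantor_int_first_left:
  assumes "M \<noteq> 0" "l < 2 ^ k"
  shows "cantor_int M (Suc k) l = (fst (cantor_int M k l) / M, snd (cantor_int M k l) / M)"
  using assms(2)
proof (induction k arbitrary: l)
  case 0
  then show ?case by simp
next
  case (Suc k)
  have "l div 2 < 2 ^ k" using Suc.prems by auto
  from Suc.IH[OF this] show ?case
    using assms(1)
    by (cases "cantor_int M k (l div 2)")
       (simp del: cantor_int.simps add: cantor_int.simps(2)[of M "Suc k" l] cantor_int.simps(2)[of M k l]
         diff_divide_distrib add_divide_distrib)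
qed

lemma cantor_int_first_right:
  assumes "M \<noteq> 0" "l < 2 ^ k"
  shows "cantor_int M (Suc k) (2 ^ k + l) =
    ((M - 1 + fst (cantor_int M k l)) / M, (M - 1 + snd (cantor_int M k l)) / M)"
  using assms(2)
proof (induction k arbitrary: l)
  case 0
  then show ?case using assms(1) by (simp add: field_simps)
next
  case (Suc k)
  have "l div 2 < 2 ^ k" using Suc.prems by auto
  note IH = Suc.IH[OF this]
  have "(2 ^ Suc k + l) div 2 = 2 ^ k + l div 2" "even (2 ^ Suc k + l) = even l" by auto
  then show ?case using assms(1) IH
    by (cases "cantor_int M k (l div 2)")
       (simp del: cantor_int.simps power_Suc
         add: cantor_int.simps(2)[of M "Suc k" "2 ^ Suc k + l"] cantor_int.simps(2)[of M k l]
         diff_divide_distrib add_divide_distrib)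
qed

lemma cantor_density_Suc:
  assumes "0 < M"
  shows "cantor_density M (Suc k) x =
    M / 2 * (cantor_density M k (M * x) + cantor_density M k (M * x - (M - 1)))"
proof -
  let ?I = "\<lambda>k l. {fst (cantor_int M k l)..snd (cantor_int M k l)}"
  have left: "indicator (?I (Suc k) l) x = (indicator (?I k l) (M * x) :: real)" if "l < 2 ^ k" for l
    using assms that
    by (simp del: cantor_int.simps add: cantor_int_first_left indicator_def field_simps)
  have right: "indicator (?I (Suc k) (2 ^ k + l)) x = (indicator (?I k l) (M * x - (M - 1)) :: real)"
    if "l < 2 ^ k" for l
    using assms cantor_int_first_right[OF _ that]
    by (simp del: cantor_int.simps add: indicator_def field_simps)
  \<comment> \<open>indices below \<open>2 ^ k\<close> have first binary digit \<open>0\<close>, the others \<open>1\<close>\<close>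
  have "{..<2 ^ Suc k} = {..<2 ^ k} \<union> (+) (2 ^ k) ` {..<2 ^ k :: nat}"
    by (simp add: image_add_atLeastLessThan lessThan_atLeast0 ivl_disj_un_two(3) mult_2)
  then have "(\<Sum>l<2 ^ Suc k. indicator (?I (Suc k) l) x :: real) =
      (\<Sum>l<2 ^ k. indicator (?I (Suc k) l) x)
      + (\<Sum>l\<in>(+) (2 ^ k) ` {..<2 ^ k}. indicator (?I (Suc k) l) x)"
    by (simp del: cantor_int.simps) (rule sum.union_disjoint, auto)
  also have "\<dots> = (\<Sum>l<2 ^ k. indicator (?I k l) (M * x))
      + (\<Sum>l<2 ^ k. indicator (?I k l) (M * x - (M - 1)))"
    by (simp del: cantor_int.simps add: sum.reindex left right)
  finally show ?thesis
    unfolding cantor_density_def by (simp add: algebra_simps)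
qed

lemma cantor_density_nonneg: "0 < M \<Longrightarrow> 0 \<le> cantor_density M k x"
  unfolding cantor_density_def by (intro mult_nonneg_nonneg sum_nonneg) auto

lemma cantor_density_borel [measurable]: "cantor_density M k \<in> borel_measurable borel"
  unfolding cantor_density_def by measurable

lemma cantor_density_outside:
  assumes "1 < M" "x < 0 \<or> 1 < x"
  shows "cantor_density M k x = 0"
  using assms(2)
proof (induction k arbitrary: x)
  case 0
  then show ?case by (auto simp: cantor_density_def)
next
  case (Suc k)
  have "M * x < 0 \<and> M * x - (M - 1) < 0" if "x < 0"
  proof -
    have "M * x < 0" using that assms by (simp add: mult_pos_neg)
    then show ?thesis using assms by simp
  qed
  moreover have "1 < M * x \<and> 1 < M * x - (M - 1)" if "1 < x"
  proof -
    have "M * 1 < M * x" using that assms by (intro mult_strict_left_mono) auto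
    then show ?thesis using assms by linarith
  qed
  ultimately have "cantor_density M k (M * x) = 0" "cantor_density M k (M * x - (M - 1)) = 0"
    using Suc by blast+
  then show ?case using assms by (simp add: cantor_density_Suc)
qed

lemma cantor_density_reflect:
  assumes "0 < M"
  shows "cantor_density M k (1 - x) = cantor_density M k x"
proof (induction k arbitrary: x)
  case 0
  then show ?case by (auto simp: cantor_density_def indicator_def)
next
  case (Suc k)
  have "M * (1 - x) = 1 - (M * x - (M - 1))" "M * (1 - x) - (M - 1) = 1 - M * x"
    by (simp_all add: algebra_simps)
  then show ?case using assms by (simp only: cantor_density_Suc Suc add.commute)
qed

lemma cantor_density_integrable: "integrable lborel (cantor_density M k)"
  unfolding cantor_density_def 
  by (intro integrable_mult_right Bochner_Integration.integrable_sum integrable_real_indicator)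
     (auto simp: emeasure_lborel_Icc_eq)

lemma integral_cantor_approx:
  fixes f :: "real \<Rightarrow> 'a::{banach, second_countable_topology}"
  assumes "0 < M" and [measurable]: "f \<in> borel_measurable borel"
  shows "(LINT x|cantor_approx M k. f x) = (LINT x|lborel. cantor_density M k x *\<^sub>R f x)"
  unfolding cantor_approx_def
  using assms(1) by (intro integral_density) (auto simp: cantor_density_nonneg)

lemma cantor_density_scaleR_integrable:
  fixes f :: "real \<Rightarrow> 'a::{banach, second_countable_topology}"
  assumes M: "0 < M" and [measurable]: "f \<in> borel_measurable borel" and B: "\<And>x. norm (f x) \<le> B"
  shows "integrable lborel (\<lambda>x. cantor_density M k x *\<^sub>R f x)"
proof (rule Bochner_Integration.integrable_bound)
  show "integrable lborel (\<lambda>x. cantor_density M k x * B)"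
    by (intro integrable_mult_left) (simp add: cantor_density_integrable)
  show "AE x in lborel. norm (cantor_density M k x *\<^sub>R f x) \<le> norm (cantor_density M k x * B)"
  proof (intro AE_I2)
    fix x
    have "norm (f x) \<le> \<bar>B\<bar>" using B[of x] by linarith
    then show "norm (cantor_density M k x *\<^sub>R f x) \<le> norm (cantor_density M k x * B)"
      using cantor_density_nonneg[OF M, of k x] by (simp add: abs_mult mult_left_mono)
  qed
qed measurable

lemma integral_cantor_approx_Suc:
  fixes f :: "real \<Rightarrow> 'a::{banach, second_countable_topology}"
  assumes M: "1 < M" and f[measurable]: "f \<in> borel_measurable borel" and B: "\<And>x. norm (f x) \<le> B"
  shows "(LINT x|cantor_approx M (Suc k). f x) =
    (1/2) *\<^sub>R (LINT x|cantor_approx M k. f (x / M)) + (1/2) *\<^sub>R (LINT x|cantor_approx M k. f ((M - 1 + x) / M))"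
proof -
  have half: "(1/2) *\<^sub>R (LINT x|cantor_approx M k. f ((c + x) / M))
      = (LINT x|lborel. (M / 2 * cantor_density M k (M * x - c)) *\<^sub>R f x)"
    and int: "integrable lborel (\<lambda>x. (M / 2 * cantor_density M k (M * x - c)) *\<^sub>R f x)" for c
  proof -
    have inv: "(c + (- c + M * x)) / M = x" for x using M by simp
    have i: "integrable lborel (\<lambda>x. cantor_density M k x *\<^sub>R f ((c + x) / M))"
      using M B by (intro cantor_density_scaleR_integrable) auto
    have "(LINT x|cantor_approx M k. f ((c + x) / M))
        = (LINT x|lborel. cantor_density M k x *\<^sub>R f ((c + x) / M))"
      using M by (intro integral_cantor_approx) auto
    also have "\<dots> = \<bar>M\<bar> *\<^sub>R (LINT x|lborel. cantor_density M k (- c + M * x) *\<^sub>R f ((c + (- c + M * x)) / M))"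
      using M by (intro lborel_integral_real_affine) auto
    finally show "(1/2) *\<^sub>R (LINT x|cantor_approx M k. f ((c + x) / M))
      = (LINT x|lborel. (M / 2 * cantor_density M k (M * x - c)) *\<^sub>R f x)"
      using M unfolding inv by (simp flip: integral_scaleR_right add: mult.assoc)
    have "integrable lborel (\<lambda>x. cantor_density M k (- c + M * x) *\<^sub>R f ((c + (- c + M * x)) / M))"
      using M i by (intro lborel_integrable_real_affine) auto
    then have "integrable lborel (\<lambda>x. (M / 2) *\<^sub>R (cantor_density M k (- c + M * x) *\<^sub>R f x))"
      unfolding inv by (rule integrable_scaleR_right)
    then show "integrable lborel (\<lambda>x. (M / 2 * cantor_density M k (M * x - c)) *\<^sub>R f x)"
      by simp
  qed
  have "(LINT x|cantor_approx M (Suc k). f x)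
      = (LINT x|lborel. (M / 2 * cantor_density M k (M * x - 0)) *\<^sub>R f x
          + (M / 2 * cantor_density M k (M * x - (M - 1))) *\<^sub>R f x)"
    using M by (subst integral_cantor_approx)
      (auto simp: cantor_density_Suc distrib_left scaleR_add_left intro!: Bochner_Integration.integral_cong)
  also have "\<dots> = (LINT x|lborel. (M / 2 * cantor_density M k (M * x - 0)) *\<^sub>R f x)
      + (LINT x|lborel. (M / 2 * cantor_density M k (M * x - (M - 1))) *\<^sub>R f x)"
    by (rule Bochner_Integration.integral_add[OF int int])
  finally show ?thesis unfolding half[symmetric] by simp
qed

lemma integral_cantor_approx_reflect:
  fixes f :: "real \<Rightarrow> 'a::{banach, second_countable_topology}"
  assumes M: "0 < M" and f[measurable]: "f \<in> borel_measurable borel"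
  shows "(LINT x|cantor_approx M k. f (1 - x)) = (LINT x|cantor_approx M k. f x)"
proof -
  have "(LINT x|lborel. cantor_density M k x *\<^sub>R f x)
      = \<bar>-1\<bar> *\<^sub>R (LINT x|lborel. cantor_density M k (1 + (-1) * x) *\<^sub>R f (1 + (-1) * x))"
    by (intro lborel_integral_real_affine) auto
  then show ?thesis using M by (simp add: integral_cantor_approx cantor_density_reflect)
qed

text \<open>
  The total mass is preserved by the recursion \<open>integral_cantor_approx_Suc\<close>, and the first density is
  the indicator of the unit interval.
\<close>

lemma cantor_approx_real_distribution:
  assumes M: "1 < M"
  shows "real_distribution (cantor_approx M k)"
proof -
  have "(LINT x|cantor_approx M k. 1 :: real) = 1"
  proof (induction k)
    case 0
    have "cantor_density M 0 = indicator {0..1}" by (auto simp: cantor_density_def)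
    then show ?case using M by (subst integral_cantor_approx) auto
  next
    case (Suc k)
    then show ?case using M by (subst integral_cantor_approx_Suc[where B=1]) auto
  qed
  then have one: "(LINT x|lborel. cantor_density M k x) = 1"
    using M integral_cantor_approx[of M "\<lambda>_. 1::real" k] by simp
  have "emeasure (cantor_approx M k) UNIV = (\<integral>\<^sup>+ x. ennreal (cantor_density M k x) \<partial>lborel)"
    unfolding cantor_approx_def by (subst emeasure_density) auto
  also have "\<dots> = ennreal (LINT x|lborel. cantor_density M k x)"
    using M by (intro nn_integral_eq_integral cantor_density_integrable) (auto simp: cantor_density_nonneg)
  finally have "emeasure (cantor_approx M k) UNIV = 1" using one by simp
  then have "prob_space (cantor_approx M k)"
    by (intro prob_spaceI) (simp add: cantor_approx_def)
  then show ?thesis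
    by (simp add: real_distribution_def real_distribution_axioms_def cantor_approx_def)
qed

section \<open>Self-similarity of the Cantor measure\<close>

locale cantor_measure =
  fixes M :: real and \<rho> :: "real measure"
  assumes M_gt: "4 < M" and cantor: "is_cantor_measure M \<rho>"
begin

lemma real_distribution_\<rho>: "real_distribution \<rho>"
  using cantor by (simp add: is_cantor_measure_def)

sublocale real_distribution \<rho> by (rule real_distribution_\<rho>)

lemma approx_integral_tendsto:
  fixes f :: "real \<Rightarrow> 'a::{banach, second_countable_topology}"
  assumes "\<And>x. isCont f x" "\<And>x. norm (f x) \<le> B"
  shows "(\<lambda>k. LINT x|cantor_approx M k. f x) \<longlonglongrightarrow> (LINT x|\<rho>. f x)"
  using M_gt cantor assms unfolding is_cantor_measure_def
  by (intro weak_conv_imp_integral_bdd_continuous_conv) (auto intro: cantor_approx_real_distribution)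

text \<open>
  The test function is bounded and continuous and vanishes exactly on the unit interval.
\<close>

lemma AE_unit: "AE y in \<rho>. y \<in> {0..1}"
proof -
  define f :: "real \<Rightarrow> real" where "f y = min 1 (max 0 (- y) + max 0 (y - 1))" for y
  have f[measurable]: "f \<in> borel_measurable borel" unfolding f_def by measurable
  have bd: "norm (f x) \<le> 1" for x by (auto simp: f_def)
  have "(LINT x|cantor_approx M k. f x) = 0" for k
  proof -
    have "cantor_density M k x *\<^sub>R f x = 0" for x
      using cantor_density_outside[of M x k] M_gt by (cases "0 \<le> x \<and> x \<le> 1") (auto simp: f_def)
    then show ?thesis using M_gt by (subst integral_cantor_approx) (simp_all del: scaleR_eq_0_iff real_scaleR_def)
  qed
  moreover have "(\<lambda>k. LINT x|cantor_approx M k. f x) \<longlonglongrightarrow> (LINT x|\<rho>. f x)"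
  proof (rule approx_integral_tendsto[OF _ bd])
    show "isCont f x" for x unfolding f_def by (intro continuous_intros)
  qed
  ultimately have "(LINT x|\<rho>. f x) = 0" by (simp add: LIMSEQ_const_iff)
  moreover have "integrable \<rho> f" using bd by (intro integrable_const_bound[where B=1]) auto
  ultimately have "AE x in \<rho>. f x = 0"
    by (subst (asm) integral_nonneg_eq_0_iff_AE) (auto simp: f_def)
  then show ?thesis by eventually_elim (auto simp: f_def min_def max_def split: if_splits)
qed

lemma integrable_bounded_on_unit:
  fixes f :: "real \<Rightarrow> real"
  assumes [measurable]: "f \<in> borel_measurable borel" and B: "\<And>y. 0 \<le> y \<Longrightarrow> y \<le> 1 \<Longrightarrow> \<bar>f y\<bar> \<le> B"
  shows "integrable \<rho> f"
proof (rule integrable_const_bound[where B=B])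
  show "AE y in \<rho>. norm (f y) \<le> B"
    using AE_unit by eventually_elim (simp add: B)
qed simp

lemma integral_cong_unit:
  fixes f g :: "real \<Rightarrow> real"
  assumes [measurable]: "f \<in> borel_measurable borel" "g \<in> borel_measurable borel"
    and "\<And>y. 0 \<le> y \<Longrightarrow> y \<le> 1 \<Longrightarrow> f y = g y"
  shows "(LINT y|\<rho>. f y) = (LINT y|\<rho>. g y)"
proof (rule integral_cong_AE)
  show "AE y in \<rho>. f y = g y"
    using AE_unit by eventually_elim (simp add: assms(3))
qed auto

text \<open>
  The average of the two scaled copies of the measure, realised as a law: a fair coin decides which of the
  two maps is applied to a random point.
\<close>

definition coin_image :: "real measure" where
  "coin_image = distr (measure_pmf (bernoulli_pmf (1/2)) \<Otimes>\<^sub>M \<rho>) borel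
     (\<lambda>(b, y). if b then y / M else (M - 1 + y) / M)"

lemma coin_map_measurable [measurable]:
  "(\<lambda>(b, y). if b then y / M else (M - 1 + y) / M)
    \<in> borel_measurable (measure_pmf (bernoulli_pmf (1/2)) \<Otimes>\<^sub>M \<rho>)"
proof -
  have "(\<lambda>(b, y). if b then y / M else (M - 1 + y) / M)
      \<in> borel_measurable (count_space UNIV \<Otimes>\<^sub>M (borel :: real measure))"
    by measurable
  then show ?thesis by (simp cong: measurable_cong_sets sets_pair_measure_cong)
qed

lemma coin_image_real_distribution: "real_distribution coin_image"
proof -
  interpret P: pair_prob_space "measure_pmf (bernoulli_pmf (1/2))" \<rho> ..
  show ?thesis
    unfolding coin_image_def real_distribution_def real_distribution_axioms_def
    by (auto intro!: P.prob_space_distr)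
qed

lemma integral_coin_image:
  fixes f :: "real \<Rightarrow> 'a::{banach, second_countable_topology}"
  assumes [measurable]: "f \<in> borel_measurable borel" and B: "\<And>x. norm (f x) \<le> B"
  shows "(LINT y|coin_image. f y) = (1/2) *\<^sub>R (LINT y|\<rho>. f (y / M)) + (1/2) *\<^sub>R (LINT y|\<rho>. f ((M - 1 + y) / M))"
proof -
  interpret P: pair_prob_space "measure_pmf (bernoulli_pmf (1/2))" \<rho> ..
  let ?T = "\<lambda>(b, y). if b then y / M else (M - 1 + y) / M"
  have "(LINT y|coin_image. f y) = (LINT x|(measure_pmf (bernoulli_pmf (1/2)) \<Otimes>\<^sub>M \<rho>). f (?T x))"
    unfolding coin_image_def by (intro integral_distr) auto
  also have "\<dots> = (LINT b|measure_pmf (bernoulli_pmf (1/2)). LINT y|\<rho>. f (?T (b, y)))"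
    by (intro P.integral_fst'[symmetric] P.integrable_const_bound[where B=B]) (auto simp: B)
  also have "\<dots> = (\<Sum>b\<in>UNIV. pmf (bernoulli_pmf (1/2)) b *\<^sub>R (LINT y|\<rho>. f (?T (b, y))))"
    by (intro integral_measure_pmf) auto
  finally show ?thesis by (simp add: UNIV_bool add.commute)
qed

text \<open>
  The recursion for the approximations passes to the weak limit in the characteristic functions, which
  determine the measure.
\<close>

lemma \<rho>_eq_coin_image: "\<rho> = coin_image"
proof (rule Levy_uniqueness[OF real_distribution_\<rho> coin_image_real_distribution], rule ext)
  fix t :: real
  let ?f = "\<lambda>x. iexp (t * x)"
  have "(\<lambda>k. LINT x|cantor_approx M (Suc k). ?f x) \<longlonglongrightarrow> (LINT x|\<rho>. ?f x)"
    by (rule LIMSEQ_Suc, rule approx_integral_tendsto[where B=1]) auto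
  moreover have "(\<lambda>k. LINT x|cantor_approx M (Suc k). ?f x) \<longlonglongrightarrow>
     (1/2) *\<^sub>R (LINT y|\<rho>. ?f (y / M)) + (1/2) *\<^sub>R (LINT y|\<rho>. ?f ((M - 1 + y) / M))"
  proof (subst integral_cantor_approx_Suc[where B=1])
    show "(\<lambda>k. (1/2) *\<^sub>R (LINT x|cantor_approx M k. ?f (x / M))
           + (1/2) *\<^sub>R (LINT x|cantor_approx M k. ?f ((M - 1 + x) / M)))
       \<longlonglongrightarrow> (1/2) *\<^sub>R (LINT y|\<rho>. ?f (y / M)) + (1/2) *\<^sub>R (LINT y|\<rho>. ?f ((M - 1 + y) / M))"
      using M_gt
      by (intro tendsto_add tendsto_scaleR tendsto_const approx_integral_tendsto[where B=1])
         (auto intro!: continuous_intros)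
  qed (use M_gt in auto)
  ultimately show "char \<rho> t = char coin_image t"
    unfolding char_def
    by (subst integral_coin_image[where B=1]) (auto intro: LIMSEQ_unique)
qed

lemma integral_self_similar:
  fixes f :: "real \<Rightarrow> real"
  assumes [measurable]: "f \<in> borel_measurable borel" and B: "\<And>y. 0 \<le> y \<Longrightarrow> y \<le> 1 \<Longrightarrow> \<bar>f y\<bar> \<le> B"
  shows "(LINT y|\<rho>. f y) = ((LINT y|\<rho>. f (y / M)) + (LINT y|\<rho>. f ((M - 1 + y) / M))) / 2"
proof -
  define g where "g y = indicator {0..1} y * f y" for y :: real
  have [measurable]: "g \<in> borel_measurable borel" unfolding g_def by measurable
  have "norm (g y) \<le> \<bar>B\<bar>" for y using B[of y] by (auto simp: g_def indicator_def)
  then have "(LINT y|\<rho>. g y) = (1/2) *\<^sub>R (LINT y|\<rho>. g (y / M)) + (1/2) *\<^sub>R (LINT y|\<rho>. g ((M - 1 + y) / M))"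
    by (subst \<rho>_eq_coin_image, intro integral_coin_image) auto
  moreover have "(LINT y|\<rho>. g y) = (LINT y|\<rho>. f y)"
    by (intro integral_cong_unit) (auto simp: g_def)
  moreover have "(LINT y|\<rho>. g (y / M)) = (LINT y|\<rho>. f (y / M))"
    using M_gt by (intro integral_cong_unit) (auto simp: g_def)
  moreover have "(LINT y|\<rho>. g ((M - 1 + y) / M)) = (LINT y|\<rho>. f ((M - 1 + y) / M))"
    using M_gt by (intro integral_cong_unit) (auto simp: g_def)
  ultimately show ?thesis by (simp add: field_simps)
qed

lemma reflect_\<rho>: "distr \<rho> borel (\<lambda>y. 1 - y) = \<rho>"
proof (rule Levy_uniqueness[OF _ real_distribution_\<rho>], simp, rule ext)
  fix t :: real
  let ?f = "\<lambda>x. iexp (t * x)"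
  have "(\<lambda>k. LINT x|cantor_approx M k. ?f (1 - x)) \<longlonglongrightarrow> (LINT x|\<rho>. ?f (1 - x))"
    by (rule approx_integral_tendsto[where B=1]) (auto intro!: continuous_intros)
  moreover have "(\<lambda>k. LINT x|cantor_approx M k. ?f x) \<longlonglongrightarrow> (LINT x|\<rho>. ?f x)"
    by (rule approx_integral_tendsto[where B=1]) auto
  moreover have "(\<lambda>k. LINT x|cantor_approx M k. ?f (1 - x)) = (\<lambda>k. LINT x|cantor_approx M k. ?f x)"
    using M_gt by (intro ext integral_cantor_approx_reflect) auto
  ultimately have "(LINT x|\<rho>. ?f (1 - x)) = (LINT x|\<rho>. ?f x)"
    using LIMSEQ_unique by metis
  then show "char (distr \<rho> borel (\<lambda>y. 1 - y)) t = char \<rho> t"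
    unfolding char_def by (subst integral_distr) auto
qed

lemma integral_reflect:
  fixes f :: "real \<Rightarrow> real"
  assumes "f \<in> borel_measurable borel"
  shows "(LINT y|\<rho>. f (1 - y)) = (LINT y|\<rho>. f y)"
  using integral_distr[of "\<lambda>y. 1 - y" \<rho> borel f] assms reflect_\<rho> by simp

lemma integral_id: "(LINT y|\<rho>. y) = 1/2"
proof -
  have "(LINT y|\<rho>. 1 - y) = (LINT y|\<rho>. y)" by (rule integral_reflect) simp
  moreover have "integrable \<rho> (\<lambda>y. y)" by (rule integrable_bounded_on_unit[where B=1]) auto
  then have "(LINT y|\<rho>. 1 - y) = 1 - (LINT y|\<rho>. y)" by (simp add: prob_space[simplified])
  ultimately show ?thesis by simp
qed

lemma prob_self_similar:
  assumes [measurable]: "S \<in> sets borel"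
  shows "prob S = (prob {y. y / M \<in> S} + prob {y. (M - 1 + y) / M \<in> S}) / 2"
proof -
  have "(LINT y|\<rho>. indicator S y :: real) =
    ((LINT y|\<rho>. indicator S (y / M)) + (LINT y|\<rho>. indicator S ((M - 1 + y) / M))) / 2"
    by (rule integral_self_similar[where B=1]) auto
  moreover have "(LINT y|\<rho>. indicator S (T y) :: real) = prob {y. T y \<in> S}"
    if [measurable]: "T \<in> borel_measurable borel" for T :: "real \<Rightarrow> real"
  proof -
    have "(\<lambda>y. indicator S (T y) :: real) = indicator {y. T y \<in> S}" by (auto simp: indicator_def)
    moreover have "{y. T y \<in> S} \<in> sets borel"
      using measurable_sets[OF that assms] by (simp add: vimage_def)
    ultimately show ?thesis by simp
  qed
  from this[of "\<lambda>y. y / M"] this[of "\<lambda>y. (M - 1 + y) / M"] have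
    "(LINT y|\<rho>. indicator S (y / M) :: real) = prob {y. y / M \<in> S}"
    "(LINT y|\<rho>. indicator S ((M - 1 + y) / M) :: real) = prob {y. (M - 1 + y) / M \<in> S}"
    by auto
  ultimately show ?thesis by simp
qed

lemma prob_outside_unit:
  assumes "S \<in> sets borel" "S \<inter> {0..1} = {}"
  shows "prob S = 0"
proof -
  have "AE y in \<rho>. y \<notin> S" using AE_unit
  proof eventually_elim
    case (elim y)
    then show ?case using assms(2) by auto
  qed
  then show ?thesis using assms(1) by (simp add: prob_eq_0)
qed

text \<open>
  Of the two preimages of a ball of radius at most \<open>1 / M\<close> at most one meets the unit interval, since their
  centres are \<open>M - 1 > 3\<close> apart; so the measure halves when the radius shrinks by \<open>M\<close>.
\<close>

lemma prob_cball_le: "prob (cball x (1 / M ^ k)) \<le> 1 / 2 ^ k"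
proof (induction k arbitrary: x)
  case 0
  then show ?case by simp
next
  case (Suc k)
  let ?r = "1 / M ^ k"
  have r: "?r \<le> 1" using M_gt by (simp add: one_le_power)
  have scale: "\<bar>x - (c + y) / M\<bar> \<le> 1 / M ^ Suc k \<longleftrightarrow> \<bar>M * x - c - y\<bar> \<le> ?r" for c y
  proof -
    have "x - (c + y) / M = (M * x - c - y) / M" using M_gt by (simp add: field_simps)
    then show ?thesis using M_gt by (simp add: abs_divide field_simps)
  qed
  have "{y. y / M \<in> cball x (1 / M ^ Suc k)} = cball (M * x) ?r"
    using scale[of 0] by (simp add: set_eq_iff dist_real_def del: power_Suc)
  moreover have "{y. (M - 1 + y) / M \<in> cball x (1 / M ^ Suc k)} = cball (M * x - (M - 1)) ?r"
    using scale[of "M - 1"] by (simp add: set_eq_iff dist_real_def del: power_Suc)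
  ultimately have eq: "prob (cball x (1 / M ^ Suc k)) =
      (prob (cball (M * x) ?r) + prob (cball (M * x - (M - 1)) ?r)) / 2"
    by (subst prob_self_similar) auto
  have "prob (cball (M * x) ?r) = 0 \<or> prob (cball (M * x - (M - 1)) ?r) = 0"
  proof (cases "M * x \<le> 2")
    case True
    have "y \<notin> {0..1}" if "y \<in> cball (M * x - (M - 1)) ?r" for y
    proof -
      have "y \<le> M * x - (M - 1) + ?r" using that by (simp add: dist_real_def abs_le_iff)
      then have "y < 0" using True r M_gt by linarith
      then show ?thesis by simp
    qed
    then have "cball (M * x - (M - 1)) ?r \<inter> {0..1} = {}" by blast
    then show ?thesis by (intro disjI2 prob_outside_unit) auto
  next
    case False
    have "y \<notin> {0..1}" if "y \<in> cball (M * x) ?r" for y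
    proof -
      have "M * x - ?r \<le> y" using that by (simp add: dist_real_def abs_le_iff)
      then have "1 < y" using False r by linarith
      then show ?thesis by simp
    qed
    then have "cball (M * x) ?r \<inter> {0..1} = {}" by blast
    then show ?thesis by (intro disjI1 prob_outside_unit) auto
  qed
  moreover have "p \<le> q / 2" if "p = (b + c) / 2" "b = 0 \<or> c = 0" "b \<le> q" "c \<le> q" for p q b c :: real
    using that by auto
  ultimately have "prob (cball x (1 / M ^ Suc k)) \<le> (1 / 2 ^ k) / 2"
    using eq Suc[of "M * x"] Suc[of "M * x - (M - 1)"] by blast
  then show ?case by simp
qed

end

section \<open>The limiting profile\<close>

text \<open>
  The dip of \<open>\<omega>\<close> below its plateau value \<open>1/2\<close> in one layer, as a function of the rescaled position
  \<open>s = M ^ j * x\<close>: it rises from \<open>M - \<alpha>\<close> to the height \<open>2\<close> at \<open>M - 2\<close> and returns to \<open>0\<close> at \<open>M\<close>.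
\<close>

definition tent :: "real \<Rightarrow> real \<Rightarrow> real \<Rightarrow> real" where
  "tent M \<alpha> s = max 0 (min (2 / (\<alpha> - 2) * (s - (M - \<alpha>))) (M - s))"

text \<open>
  The pointwise limit of the functions \<open>\<omega>\<^sub>k\<close>: for \<open>k\<close> larger than the layer of \<open>x\<close> the innermost slope, the only
  piece with coefficient \<open>3/4\<close>, has moved past \<open>x\<close>.
\<close>

definition omega_lim :: "real \<Rightarrow> real \<Rightarrow> real \<Rightarrow> real" where
  "omega_lim M \<alpha> x = sgn x *
     (let j = (LEAST j. 1 / M ^ j < \<bar>x\<bar>) in
      if j = 0 then 1/2 else 1/2 - tent M \<alpha> (M ^ j * \<bar>x\<bar>))"

lemma omega_lim_odd: "omega_lim M \<alpha> (- x) = - omega_lim M \<alpha> x"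
  by (simp add: omega_lim_def sgn_minus Let_def)

lemma layer_exists:
  fixes M t :: real
  assumes "1 < M" "0 < t" "t \<le> 1"
  obtains j where "1 \<le> j" "1 / M ^ j < t" "t \<le> M / M ^ j" "(LEAST j. 1 / M ^ j < t) = j"
proof -
  define j where "j = (LEAST j. 1 / M ^ j < t)"
  obtain n where "1 / t < M ^ n" using real_arch_pow[OF assms(1)] by blast
  then have "1 / M ^ n < t" using assms by (simp add: field_simps)
  then have lt: "1 / M ^ j < t" unfolding j_def by (rule LeastI)
  then have "j \<noteq> 0" using assms by (intro notI) simp
  then obtain i where i: "j = Suc i" using not0_implies_Suc by blast
  then have "\<not> 1 / M ^ i < t" unfolding j_def by (intro not_less_Least) simp
  then have "t \<le> M / M ^ j" using i assms by simp
  then show ?thesis using that[of j] lt i j_def by (simp del: power_Suc)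
qed

locale omega_params =
  fixes M \<alpha> :: real
  assumes \<alpha>_gt: "2 < \<alpha>" and \<alpha>_lt: "\<alpha> < M - 2"
begin

definition \<epsilon> :: real where "\<epsilon> = 2 / (\<alpha> - 2)"

lemma \<epsilon>_pos: "0 < \<epsilon>" using \<alpha>_gt by (simp add: \<epsilon>_def)

lemma tent_eq: "tent M \<alpha> s = max 0 (min (\<epsilon> * (s - (M - \<alpha>))) (M - s))"
  by (simp only: tent_def \<epsilon>_def)

lemma \<epsilon>_mult: "\<epsilon> * (\<alpha> - 2) = 2" using \<alpha>_gt by (simp add: \<epsilon>_def field_simps)

lemma tent_eq_0: "s \<le> M - \<alpha> \<or> M \<le> s \<Longrightarrow> tent M \<alpha> s = 0"
  using mult_nonneg_nonpos[of \<epsilon> "s - (M - \<alpha>)"] \<epsilon>_pos by (auto simp: tent_eq)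

lemma tent_rise:
  assumes "M - \<alpha> \<le> s" "s \<le> M - 2"
  shows "tent M \<alpha> s = \<epsilon> * (s - (M - \<alpha>))"
proof -
  have "\<epsilon> * (s - (M - \<alpha>)) \<le> \<epsilon> * (\<alpha> - 2)" using assms \<epsilon>_pos by (intro mult_left_mono) auto
  moreover have "0 \<le> \<epsilon> * (s - (M - \<alpha>))" using assms \<epsilon>_pos by (intro mult_nonneg_nonneg) auto
  ultimately show ?thesis using assms \<epsilon>_mult by (simp add: tent_eq)
qed

lemma tent_fall:
  assumes "M - 2 \<le> s" "s \<le> M"
  shows "tent M \<alpha> s = M - s"
proof -
  have "\<epsilon> * (\<alpha> - 2) \<le> \<epsilon> * (s - (M - \<alpha>))" using assms \<epsilon>_pos by (intro mult_left_mono) auto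
  then show ?thesis using assms \<epsilon>_mult by (simp add: tent_eq)
qed

lemma tent_nonneg: "0 \<le> tent M \<alpha> s" by (simp add: tent_eq)

lemma tent_le_2: "tent M \<alpha> s \<le> 2"
proof (cases "s \<le> M - 2")
  case True
  show ?thesis
  proof (cases "M - \<alpha> \<le> s")
    case True
    have "\<epsilon> * (s - (M - \<alpha>)) \<le> \<epsilon> * (\<alpha> - 2)"
      using \<open>s \<le> M - 2\<close> \<epsilon>_pos by (intro mult_left_mono) auto
    then show ?thesis using tent_rise[OF True \<open>s \<le> M - 2\<close>] \<epsilon>_mult by simp
  qed (simp add: tent_eq_0)
next
  case False
  then show ?thesis by (simp add: tent_eq)
qed

lemma tent_lipschitz:
  assumes "\<epsilon> \<le> 1"
  shows "\<bar>tent M \<alpha> s - tent M \<alpha> s'\<bar> \<le> \<bar>s - s'\<bar>"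
proof -
  have "\<bar>\<epsilon> * (s - (M - \<alpha>)) - \<epsilon> * (s' - (M - \<alpha>))\<bar> = \<epsilon> * \<bar>s - s'\<bar>"
    using \<epsilon>_pos by (simp only: right_diff_distrib[symmetric] abs_mult) simp
  also have "\<dots> \<le> \<bar>s - s'\<bar>" using assms by (intro mult_left_le_one_le) (use \<epsilon>_pos in auto)
  finally show ?thesis unfolding tent_eq by linarith
qed

lemma omega_lim_eq_layer:
  assumes "1 \<le> j" "1 / M ^ j \<le> t" "t \<le> M / M ^ j"
  shows "omega_lim M \<alpha> t = 1/2 - tent M \<alpha> (M ^ j * t)"
proof (cases "t = 1 / M ^ j")
  case True
  have "0 < t" using True \<alpha>_gt \<alpha>_lt by simp
  have "(LEAST i. 1 / M ^ i < t) = Suc j"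
    using True \<alpha>_gt \<alpha>_lt by (intro layer_eq) (auto simp: divide_strict_left_mono)
  then show ?thesis using True \<open>0 < t\<close> \<alpha>_gt \<alpha>_lt by (simp add: omega_lim_def tent_eq_0)
next
  case False
  have "0 < 1 / M ^ j" using \<alpha>_gt \<alpha>_lt by simp
  then have "0 < t" using assms by linarith
  have "(LEAST i. 1 / M ^ i < t) = j"
    using False assms \<alpha>_gt \<alpha>_lt by (intro layer_eq) auto
  then show ?thesis using \<open>0 < t\<close> assms(1) by (simp add: omega_lim_def)
qed

lemma omega_lim_outer: "1 \<le> t \<Longrightarrow> omega_lim M \<alpha> t = 1/2"
  using omega_lim_eq_layer[of 1 t] layer_zero[of t M] \<alpha>_gt \<alpha>_lt tent_eq_0[of M]
  by (cases "t = 1") (auto simp: omega_lim_def)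

lemma omega_lim_outer_layer:
  assumes "1 / M \<le> t"
  shows "omega_lim M \<alpha> t = 1/2 - tent M \<alpha> (M * t)"
proof (cases "t \<le> 1")
  case True
  then show ?thesis using omega_lim_eq_layer[of 1 t] assms \<alpha>_gt \<alpha>_lt by simp
next
  case False
  then have "M * 1 \<le> M * t" using \<alpha>_gt \<alpha>_lt by (intro mult_left_mono) auto
  then show ?thesis using False omega_lim_outer[of t] tent_eq_0[of "M * t"] by simp
qed

text \<open>
  Up to \<open>t = 1\<close> the layers are shifted by one; between \<open>1\<close> and \<open>M - \<alpha>\<close> both sides are on the plateau.
\<close>

lemma omega_lim_scale:
  assumes "0 < t" "t \<le> M - \<alpha>"
  shows "omega_lim M \<alpha> (t / M) = omega_lim M \<alpha> t"
proof (cases "t \<le> 1")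
  case True
  then obtain j where j: "1 \<le> j" "1 / M ^ j < t" "t \<le> M / M ^ j"
    using layer_exists[of M t] assms \<alpha>_gt \<alpha>_lt by auto
  have "omega_lim M \<alpha> (t / M) = 1/2 - tent M \<alpha> (M ^ Suc j * (t / M))"
    using j \<alpha>_gt \<alpha>_lt by (intro omega_lim_eq_layer) (auto simp: field_simps)
  then show ?thesis using omega_lim_eq_layer[of j t] j \<alpha>_gt \<alpha>_lt by simp
next
  case False
  then show ?thesis
    using assms omega_lim_outer[of t] omega_lim_outer_layer[of "t / M"] \<alpha>_gt \<alpha>_lt
    by (simp add: tent_eq_0 divide_right_mono)
qed

lemma omega_lim_bounds:
  assumes "0 < t"
  shows "- 3/2 \<le> omega_lim M \<alpha> t" "omega_lim M \<alpha> t \<le> 1/2"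
  using assms tent_nonneg[of "M ^ (LEAST j. 1 / M ^ j < t) * t"] tent_le_2[of "M ^ (LEAST j. 1 / M ^ j < t) * t"]
  by (auto simp: omega_lim_def Let_def)

lemma omega_lim_abs_le: "\<bar>omega_lim M \<alpha> x\<bar> \<le> 3/2"
proof (cases x "0 :: real" rule: linorder_cases)
  case less
  then show ?thesis using omega_lim_bounds[of "- x"] omega_lim_odd[of M \<alpha> x] by simp
next
  case equal
  then show ?thesis by (simp add: omega_lim_def)
next
  case greater
  then show ?thesis using omega_lim_bounds[of x] by simp
qed

text \<open>
  Within one layer the slope is at most \<open>M ^ j \<le> M / t\<close>.  Points of different layers are compared through the
  right end \<open>b\<close> of the layer of the smaller one, where \<open>\<omega>\<close> is on the plateau; the layer of the larger one
  starts beyond \<open>b\<close> and has a smaller slope.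
\<close>

lemma omega_lim_diff_le:
  assumes \<epsilon>1: "\<epsilon> \<le> 1" and "0 < \<delta>" "\<delta> \<le> t" "t \<le> t'"
  shows "\<bar>omega_lim M \<alpha> t - omega_lim M \<alpha> t'\<bar> \<le> M / \<delta> * (t' - t)"
proof (cases "t \<le> 1")
  case False
  then have "omega_lim M \<alpha> t = omega_lim M \<alpha> t'"
    using assms omega_lim_outer[of t] omega_lim_outer[of t'] by simp
  then show ?thesis using assms \<alpha>_gt \<alpha>_lt by simp
next
  case True
  have M0: "0 < M" using \<alpha>_gt \<alpha>_lt by simp
  obtain j where j: "1 \<le> j" "1 / M ^ j < t" "t \<le> M / M ^ j"
    using layer_exists[of M t] True assms \<alpha>_gt \<alpha>_lt by auto
  have slope: "M ^ j \<le> M / \<delta>"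
  proof -
    have "M ^ j * \<delta> \<le> M ^ j * (M / M ^ j)" using j assms M0 by (intro mult_left_mono) auto
    then show ?thesis using assms M0 by (simp add: field_simps)
  qed
  have same: "\<bar>omega_lim M \<alpha> t - omega_lim M \<alpha> s\<bar> \<le> M ^ j * (s - t)" if "t \<le> s" "s \<le> M / M ^ j" for s
  proof -
    have "\<bar>tent M \<alpha> (M ^ j * s) - tent M \<alpha> (M ^ j * t)\<bar> \<le> \<bar>M ^ j * s - M ^ j * t\<bar>"
      by (rule tent_lipschitz[OF \<epsilon>1])
    also have "\<dots> = M ^ j * (s - t)" using that M0
      by (simp add: right_diff_distrib[symmetric] abs_mult)
    finally show ?thesis using omega_lim_eq_layer[of j t] omega_lim_eq_layer[of j s] that j by simp
  qed
  have "\<bar>omega_lim M \<alpha> t - omega_lim M \<alpha> t'\<bar> \<le> M ^ j * (t' - t)"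
  proof (cases "t' \<le> M / M ^ j")
    case True
    then show ?thesis using same assms by simp
  next
    case False
    \<comment> \<open>the right end of the layer of \<open>t\<close>\<close>
    define b where "b = M / M ^ j"
    have b1: "b \<le> 1" using j M0 \<alpha>_gt \<alpha>_lt power_increasing[of 1 j M] by (simp add: b_def)
    have b0: "0 < b" using M0 by (simp add: b_def)
    have omb: "omega_lim M \<alpha> b = 1/2"
      using omega_lim_eq_layer[of j b] j M0 \<alpha>_gt \<alpha>_lt
      by (simp add: b_def tent_eq_0 divide_right_mono)
    have "\<bar>omega_lim M \<alpha> b - omega_lim M \<alpha> t'\<bar> \<le> M ^ j * (t' - b)"
    proof (cases "t' \<le> 1")
      case False
      then have "omega_lim M \<alpha> b = omega_lim M \<alpha> t'" using omega_lim_outer[of t'] omb by simp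
      then show ?thesis using False b1 M0 by simp
    next
      case True
      have t'0: "0 < t'" using assms by simp
      obtain i where i: "1 \<le> i" "1 / M ^ i < t'" "t' \<le> M / M ^ i"
        using layer_exists[of M t'] True t'0 \<alpha>_gt \<alpha>_lt by auto
      have ij: "i < j"
      proof (rule ccontr)
        assume "\<not> i < j"
        then have "M ^ j \<le> M ^ i" using \<alpha>_gt \<alpha>_lt by (intro power_increasing) auto
        then have "M / M ^ i \<le> M / M ^ j" using M0 by (intro divide_left_mono) auto
        then show False using i False by simp
      qed
      have "M * M ^ i \<le> M ^ j"
        using power_increasing[of "Suc i" j M] ij \<alpha>_gt \<alpha>_lt by simp
      then have bi: "b \<le> 1 / M ^ i" using M0 by (simp add: b_def field_simps)
      have "\<bar>tent M \<alpha> (M ^ i * t') - tent M \<alpha> 1\<bar> \<le> \<bar>M ^ i * t' - 1\<bar>"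
        by (rule tent_lipschitz[OF \<epsilon>1])
      also have "\<bar>M ^ i * t' - 1\<bar> = M ^ i * (t' - 1 / M ^ i)"
        using i M0 by (simp add: field_simps)
      also have "\<dots> \<le> M ^ j * (t' - b)"
        using bi ij M0 \<alpha>_gt \<alpha>_lt i False
        by (intro mult_mono power_increasing) (auto simp: b_def)
      finally show ?thesis using omb omega_lim_eq_layer[of i t'] i tent_eq_0[of 1] \<alpha>_gt \<alpha>_lt
        by simp
    qed
    moreover have "\<bar>omega_lim M \<alpha> t - omega_lim M \<alpha> b\<bar> \<le> M ^ j * (b - t)"
      using same[of b] j by (simp add: b_def)
    ultimately show ?thesis by (simp add: right_diff_distrib)
  qed
  also have "\<dots> \<le> M / \<delta> * (t' - t)" using slope assms by (intro mult_right_mono) auto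
  finally show ?thesis .
qed

lemma omega_lim_borel [measurable]:
  "omega_lim M \<alpha> \<in> borel_measurable borel"
proof -
  define f where "f t = (let j = (LEAST j. 1 / M ^ j < t) in
      if j = 0 then 1/2 else 1/2 - tent M \<alpha> (M ^ j * t))" for t :: real
  have [measurable]: "tent M \<alpha> \<in> borel_measurable borel" unfolding tent_def by measurable
  have "f \<in> borel_measurable borel" unfolding f_def Let_def by measurable
  moreover have "omega_lim M \<alpha> = (\<lambda>x. sgn x * f \<bar>x\<bar>)" by (auto simp: omega_lim_def f_def)
  ultimately show ?thesis by simp
qed

lemma omega_eventually_eq:
  assumes "x \<noteq> 0"
  shows "\<forall>\<^sub>F k in sequentially. omega M \<alpha> k x = omega_lim M \<alpha> x"
proof -
  define j where "j = (LEAST j. 1 / M ^ j < \<bar>x\<bar>)"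
  have "omega M \<alpha> k x = omega_lim M \<alpha> x" if k: "j < k" for k
  proof (cases "j = 0")
    case True
    then show ?thesis by (simp add: omega_def omega_lim_def omega_pos_def j_def Let_def)
  next
    case False
    have M0: "0 < M" using \<alpha>_gt \<alpha>_lt by simp
    have "\<bar>x\<bar> \<le> 1"
      using False layer_zero[of "\<bar>x\<bar>" M] unfolding j_def by (cases "1 < \<bar>x\<bar>") auto
    then have le: "\<bar>x\<bar> \<le> M / M ^ j"
      using layer_exists[of M "\<bar>x\<bar>"] assms \<alpha>_gt \<alpha>_lt j_def by auto
    let ?s = "M ^ j * \<bar>x\<bar>"
    have s: "\<bar>x\<bar> \<le> c / M ^ j \<longleftrightarrow> ?s \<le> c" for c using M0 by (simp add: field_simps)
    have e: "\<epsilon> * (M - 2) - \<epsilon> * (M - \<alpha>) = 2"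
      using \<epsilon>_mult by (simp only: right_diff_distrib[symmetric]) simp
    have "(if ?s \<le> M - \<alpha> then 1/2
       else if ?s \<le> M - 2 then (- 3/2 + \<epsilon> * (M - 2)) - \<epsilon> * M ^ j * \<bar>x\<bar>
       else - (M - 1/2) + ?s) = 1/2 - tent M \<alpha> ?s"
      using tent_eq_0[of ?s] tent_rise[of ?s] tent_fall[of ?s] e le s
      by (auto simp: right_diff_distrib mult.assoc)
    moreover have "omega_pos M \<alpha> k \<bar>x\<bar> = (if ?s \<le> M - \<alpha> then 1/2
       else if ?s \<le> M - 2 then (- 3/2 + \<epsilon> * (M - 2)) - \<epsilon> * M ^ j * \<bar>x\<bar>
       else - (M - 1/2) + ?s)"
      using False k unfolding omega_pos_def j_def[symmetric] Let_def s \<epsilon>_def by simp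
    moreover have "omega_lim M \<alpha> x = sgn x * (1/2 - tent M \<alpha> ?s)"
      using False unfolding omega_lim_def j_def[symmetric] Let_def by simp
    ultimately show ?thesis by (simp only: omega_def)
  qed
  then show ?thesis unfolding eventually_sequentially by (intro exI[of _ "Suc j"]) simp
qed

end

section \<open>Comparing increments through derivatives\<close>

lemma DERIV_le_imp_increment_le:
  fixes f g :: "real \<Rightarrow> real"
  assumes "a \<le> b"
    and "\<And>x. a \<le> x \<Longrightarrow> x \<le> b \<Longrightarrow> (f has_real_derivative f' x) (at x)"
    and "\<And>x. a \<le> x \<Longrightarrow> x \<le> b \<Longrightarrow> (g has_real_derivative g' x) (at x)"
    and "\<And>x. a \<le> x \<Longrightarrow> x \<le> b \<Longrightarrow> f' x \<le> g' x"
  shows "f b - f a \<le> g b - g a"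
proof -
  have "g a - f a \<le> g b - f b"
  proof (rule DERIV_nonneg_imp_nondecreasing[OF assms(1)])
    fix x assume x: "a \<le> x" "x \<le> b"
    show "\<exists>y. ((\<lambda>x. g x - f x) has_real_derivative y) (at x) \<and> 0 \<le> y"
      using assms(4)[OF x] DERIV_diff[OF assms(3)[OF x] assms(2)[OF x]]
      by (intro exI[of _ "g' x - f' x"]) auto
  qed
  then show ?thesis by simp
qed

lemma DERIV_eq_imp_increment_eq:
  fixes f g :: "real \<Rightarrow> real"
  assumes "a \<le> b"
    and "\<And>x. a \<le> x \<Longrightarrow> x \<le> b \<Longrightarrow> (f has_real_derivative f' x) (at x)"
    and "\<And>x. a \<le> x \<Longrightarrow> x \<le> b \<Longrightarrow> (g has_real_derivative f' x) (at x)"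
  shows "f b - f a = g b - g a"
  using DERIV_le_imp_increment_le[of a b f f' g f'] DERIV_le_imp_increment_le[of a b g f' f f'] assms
  by fastforce

section \<open>The convolution and its derivative\<close>

locale cantor_energy =
  fixes M \<alpha> :: real and W :: "real \<Rightarrow> real" and \<rho> :: "real measure"
  assumes \<alpha>_lower: "1/3 * (M + 2) < \<alpha>" and \<alpha>_upper: "\<alpha> \<le> 2/5 * (M - 10)"
    and limit_potential: "is_limit_potential M \<alpha> W"
    and cantor_measure: "is_cantor_measure M \<rho>"
begin

lemma \<alpha>_le: "\<alpha> \<le> 2/5 * M - 4" using \<alpha>_upper by simp

lemma M_gt_70: "70 < M" using \<alpha>_lower \<alpha>_upper by simp

lemma \<alpha>_gt_24: "24 < \<alpha>" using \<alpha>_lower M_gt_70 by simp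

sublocale omega_params M \<alpha>
  using \<alpha>_gt_24 \<alpha>_upper M_gt_70 by unfold_locales auto

sublocale cantor_measure M \<rho>
  using cantor_measure M_gt_70 by unfold_locales auto

text \<open>
  With \<open>b = a / M\<close> one has \<open>a = 1/2 + 2 * b\<close>, which makes the scaling identities below linear in \<open>b\<close>.
\<close>

definition a :: real where "a = M / (2 * M - 4)"

definition b :: real where "b = 1 / (2 * M - 4)"

lemma a_eq: "a = 1/2 + 2 * b"
  using M_gt_70 by (simp add: a_def b_def field_simps)

lemma b_eq: "a / M = b"
  using M_gt_70 by (simp add: a_def b_def field_simps)

lemma a_times_divide: "a * (s / M) = b * s"
  by (simp flip: b_eq)

lemma b_pos: "0 < b" using M_gt_70 by (simp add: b_def)

lemma a_bounds: "1/2 \<le> a" "a \<le> 1"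
  using M_gt_70 by (simp_all add: a_def field_simps)

definition W' :: "real \<Rightarrow> real" where
  "W' x = a * (2 * x - sgn x) + omega_lim M \<alpha> x"

lemma W_has_derivative:
  assumes "x \<noteq> 0"
  shows "(W has_real_derivative W' x) (at x)"
proof -
  obtain d where d: "(W has_real_derivative d) (at x)" "(\<lambda>k. W_deriv M \<alpha> k x) \<longlonglongrightarrow> d"
    using limit_potential assms by (auto simp: is_limit_potential_def)
  have "sgn x * (M / (2 * M - 4) * (- 1 + 2 * \<bar>x\<bar>)) = a * (2 * x - sgn x)"
    using assms by (cases "0 < x") (auto simp: a_def algebra_simps)
  then have "\<forall>\<^sub>F k in sequentially. W_deriv M \<alpha> k x = W' x"
    using omega_eventually_eq[OF assms] by (auto elim!: eventually_mono simp: W_deriv_def W'_def)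
  then have "(\<lambda>k. W_deriv M \<alpha> k x) \<longlonglongrightarrow> W' x" by (rule tendsto_eventually)
  then show ?thesis using d LIMSEQ_unique by blast
qed

lemma W_even: "W (- x) = W x"
  using limit_potential by (simp add: is_limit_potential_def)

lemma W_continuous: "isCont W x"
proof -
  obtain r L where "0 < r" "L-lipschitz_on (ball x r) W"
    using limit_potential unfolding is_limit_potential_def locally_lipschitz_def by meson
  then have "continuous_on (ball x r) W" by (intro lipschitz_on_continuous_on)
  then show ?thesis using \<open>0 < r\<close> continuous_on_interior[of "ball x r" W x] by simp
qed

lemma W_borel [measurable]: "W \<in> borel_measurable borel"
  by (intro borel_measurable_continuous_onI continuous_at_imp_continuous_on ballI W_continuous)

lemma W'_odd: "W' (- x) = - W' x"
  by (simp add: W'_def omega_lim_odd sgn_minus algebra_simps)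

lemma W'_0: "W' 0 = 0" by (simp add: W'_def omega_lim_def)

lemma W'_pos: "0 < x \<Longrightarrow> W' x = a * (2 * x - 1) + omega_lim M \<alpha> x"
  by (simp add: W'_def)

lemma W'_borel [measurable]: "W' \<in> borel_measurable borel"
  unfolding W'_def by measurable

lemma W'_abs_le: "\<bar>W' x\<bar> \<le> 2 * \<bar>x\<bar> + 5/2"
proof -
  have "\<bar>a * (2 * x - sgn x)\<bar> \<le> 1 * (2 * \<bar>x\<bar> + 1)"
    unfolding abs_mult using a_bounds
    by (intro mult_mono) (auto simp: sgn_real_def abs_if)
  then have "\<bar>a * (2 * x - sgn x)\<bar> + \<bar>omega_lim M \<alpha> x\<bar> \<le> 1 * (2 * \<bar>x\<bar> + 1) + 3/2"
    by (rule add_mono) (rule omega_lim_abs_le)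
  with abs_triangle_ineq have "\<bar>W' x\<bar> \<le> 1 * (2 * \<bar>x\<bar> + 1) + 3/2"
    unfolding W'_def by (rule order_trans)
  then show ?thesis by simp
qed

text \<open>
  Evenness reduces the claim to nonnegative arguments, so that the mean value theorem never meets the kink at \<open>0\<close>.
\<close>

lemma W_lipschitz:
  assumes "\<bar>x\<bar> \<le> R" "\<bar>x'\<bar> \<le> R"
  shows "\<bar>W x - W x'\<bar> \<le> (2 * R + 5/2) * \<bar>x - x'\<bar>"
proof -
  have pos: "\<bar>W s - W t\<bar> \<le> (2 * R + 5/2) * (t - s)" if st: "0 \<le> s" "s < t" "t \<le> R" for s t
  proof -
    have "continuous_on {s..t} W" by (intro continuous_at_imp_continuous_on ballI W_continuous)
    moreover have "W differentiable (at x)" if "s < x" for x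
      using W_has_derivative[of x] st that by (auto simp: real_differentiable_def)
    ultimately obtain l z where z: "s < z" "z < t" "(W has_real_derivative l) (at z)" "W t - W s = (t - s) * l"
      using MVT[OF st(2), of W] by blast
    have "l = W' z" using W_has_derivative[of z] z st DERIV_unique by force
    then have "\<bar>l\<bar> \<le> 2 * R + 5/2" using W'_abs_le[of z] z st by simp
    then have "(t - s) * \<bar>l\<bar> \<le> (t - s) * (2 * R + 5/2)" using st by (intro mult_left_mono) auto
    moreover have "W s - W t = - ((t - s) * l)" using z(4) by simp
    then have "\<bar>W s - W t\<bar> = (t - s) * \<bar>l\<bar>" using st by (simp add: abs_mult)
    ultimately show ?thesis by (simp add: mult.commute)
  qed
  have abs: "W y = W \<bar>y\<bar>" for y using W_even[of y] by (simp add: abs_if)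
  have "\<bar>W \<bar>x\<bar> - W \<bar>x'\<bar>\<bar> \<le> (2 * R + 5/2) * \<bar>\<bar>x\<bar> - \<bar>x'\<bar>\<bar>"
    using pos[of "\<bar>x\<bar>" "\<bar>x'\<bar>"] pos[of "\<bar>x'\<bar>" "\<bar>x\<bar>"] assms
    by (cases "\<bar>x\<bar>" "\<bar>x'\<bar>" rule: linorder_cases) (auto simp: abs_minus_commute)
  also have "\<dots> \<le> (2 * R + 5/2) * \<bar>x - x'\<bar>"
    using assms by (intro mult_left_mono) auto
  finally show ?thesis using abs[of x] abs[of x'] by simp
qed

lemma AE_neq: "AE y in \<rho>. y \<noteq> x"
proof -
  have "prob {x} \<le> (1/2) ^ k" for k
  proof -
    have "0 < M" using M_gt_70 by simp
    then have "prob {x} \<le> prob (cball x (1 / M ^ k))"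
      by (intro finite_measure_mono) auto
    then show ?thesis using prob_cball_le[of x k] by (simp add: power_one_over)
  qed
  moreover have "(\<lambda>k. (1/2 :: real) ^ k) \<longlonglongrightarrow> 0" by (rule LIMSEQ_power_zero) simp
  ultimately have "prob {x} \<le> 0" by (intro LIMSEQ_le_const) auto
  then have "prob {x} = 0" using measure_nonneg[of \<rho> "{x}"] by linarith
  then show ?thesis using prob_eq_0[of "{x}"] by simp
qed

text \<open>
  The derivative of the convolution.  The force \<open>W'\<close> has the value \<open>0\<close> at \<open>0\<close>, where \<open>deriv W\<close> is unspecified;
  at \<open>x - y\<close> the two agree for almost every \<open>y\<close> because the measure has no atoms.
\<close>

definition V' :: "real \<Rightarrow> real" where "V' x = expectation (\<lambda>y. W' (x - y))"

lemma W_integrable: "integrable \<rho> (\<lambda>y. W (x - y))"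
proof (rule integrable_bounded_on_unit)
  show "\<bar>W (x - y)\<bar> \<le> \<bar>W x\<bar> + (2 * (\<bar>x\<bar> + 1) + 5/2)" if "0 \<le> y" "y \<le> 1" for y
  proof -
    have "\<bar>W (x - y) - W x\<bar> \<le> (2 * (\<bar>x\<bar> + 1) + 5/2) * \<bar>(x - y) - x\<bar>"
      using that by (intro W_lipschitz) auto
    also have "\<dots> \<le> (2 * (\<bar>x\<bar> + 1) + 5/2) * 1" using that by (intro mult_left_mono) auto
    finally have "\<bar>W x\<bar> + \<bar>W (x - y) - W x\<bar> \<le> \<bar>W x\<bar> + (2 * (\<bar>x\<bar> + 1) + 5/2)" by simp
    moreover have "\<bar>W (x - y)\<bar> \<le> \<bar>W x\<bar> + \<bar>W (x - y) - W x\<bar>"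
      using abs_triangle_ineq[of "W x" "W (x - y) - W x"] by simp
    ultimately show ?thesis by (rule order_trans[rotated])
  qed
qed measurable

lemma W'_bounded_on_unit:
  assumes "0 \<le> y" "y \<le> 1"
  shows "\<bar>W' (x - y)\<bar> \<le> 2 * \<bar>x\<bar> + 5" "\<bar>W' (x + y)\<bar> \<le> 2 * \<bar>x\<bar> + 5"
  using W'_abs_le[of "x - y"] W'_abs_le[of "x + y"] abs_triangle_ineq4[of x y] abs_triangle_ineq[of x y] assms
  by simp_all

lemma W'_integrable: "integrable \<rho> (\<lambda>y. W' (x - y))"
  by (rule integrable_bounded_on_unit[where B="2 * \<bar>x\<bar> + 5"]) (auto simp: W'_bounded_on_unit)

lemma AE_deriv_W: "AE y in \<rho>. deriv W (x - y) = W' (x - y)"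
  using AE_neq[of x]
proof eventually_elim
  case (elim y)
  then show ?case using W_has_derivative[of "x - y"] by (auto intro!: DERIV_imp_deriv)
qed

lemma deriv_W_borel [measurable]: "deriv W \<in> borel_measurable borel"
proof -
  have "deriv W = (\<lambda>x. if x = 0 then deriv W 0 else W' x)"
    by (intro ext) (simp add: DERIV_imp_deriv[OF W_has_derivative])
  moreover have "(\<lambda>x. if x = 0 then deriv W 0 else W' x) \<in> borel_measurable borel" by measurable
  ultimately show ?thesis by simp
qed

lemma conv_deriv_W: "conv (deriv W) \<rho> x = V' x"
  unfolding conv_def V'_def using AE_deriv_W by (intro integral_cong_AE) auto

lemma deriv_W_integrable: "integrable \<rho> (\<lambda>y. deriv W (x - y))"
proof -
  have "integrable \<rho> (\<lambda>y. deriv W (x - y)) \<longleftrightarrow> integrable \<rho> (\<lambda>y. W' (x - y))"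
    using AE_deriv_W by (intro integrable_cong_AE) auto
  then show ?thesis using W'_integrable by simp
qed

text \<open>
  Dominated convergence: the difference quotients of \<open>W\<close> are bounded by a local Lipschitz constant and converge
  off the single point \<open>y = x\<close>.
\<close>

lemma conv_W_has_derivative: "(conv W \<rho> has_real_derivative V' x) (at x)"
proof -
  have "((\<lambda>h. (conv W \<rho> (x + h) - conv W \<rho> x) / h) \<longlongrightarrow> V' x) (at 0)"
    unfolding tendsto_at_iff_sequentially comp_def
  proof (intro allI impI)
    fix h :: "nat \<Rightarrow> real"
    assume h0: "\<forall>i. h i \<in> UNIV - {0}" and h: "h \<longlonglongrightarrow> 0"
    have "Bseq h" using h by (intro convergent_imp_Bseq convergentI)
    then obtain r where r: "\<And>i. \<bar>h i\<bar> \<le> r" by (auto simp: Bseq_def)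
    let ?R = "\<bar>x\<bar> + r + 1"
    have quot: "(conv W \<rho> (x + h i) - conv W \<rho> x) / h i
        = expectation (\<lambda>y. (W (x + h i - y) - W (x - y)) / h i)" for i
      using W_integrable[of "x + h i"] W_integrable[of x] by (simp add: conv_def)
    have "(\<lambda>i. expectation (\<lambda>y. (W (x + h i - y) - W (x - y)) / h i)) \<longlonglongrightarrow> V' x"
      unfolding V'_def
    proof (rule integral_dominated_convergence[where w="\<lambda>_. 2 * ?R + 5/2"])
      show "AE y in \<rho>. (\<lambda>i. (W (x + h i - y) - W (x - y)) / h i) \<longlonglongrightarrow> W' (x - y)"
        using AE_neq[of x]
      proof eventually_elim
        case (elim y)
        then have "((\<lambda>h. (W (x - y + h) - W (x - y)) / h) \<longlongrightarrow> W' (x - y)) (at 0)"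
          using W_has_derivative[of "x - y"] by (simp add: DERIV_def)
        then have "((\<lambda>h. (W (x - y + h) - W (x - y)) / h) \<circ> h) \<longlonglongrightarrow> W' (x - y)"
          using h0 h unfolding tendsto_at_iff_sequentially by blast
        then show ?case by (simp add: comp_def algebra_simps)
      qed
      show "AE y in \<rho>. norm ((W (x + h i - y) - W (x - y)) / h i) \<le> 2 * ?R + 5/2" for i
        using AE_unit
      proof eventually_elim
        case (elim y)
        have "\<bar>W (x + h i - y) - W (x - y)\<bar> \<le> (2 * ?R + 5/2) * \<bar>x + h i - y - (x - y)\<bar>"
          using elim r[of i] by (intro W_lipschitz) auto
        then show ?case using h0[rule_format, of i] by (simp add: abs_divide divide_le_eq)
      qed
    qed auto
    then show "(\<lambda>i. (conv W \<rho> (x + h i) - conv W \<rho> x) / h i) \<longlonglongrightarrow> V' x"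
      by (simp only: quot)
  qed
  then show ?thesis by (simp add: DERIV_def)
qed

definition excess :: "real \<Rightarrow> real" where "excess x = conv W \<rho> x - conv W \<rho> 0"

lemma excess_has_derivative: "(excess has_real_derivative V' x) (at x)"
  unfolding excess_def by (auto intro!: derivative_eq_intros conv_W_has_derivative)

lemma excess_0: "excess 0 = 0" by (simp add: excess_def)

lemma conv_W_reflect: "conv W \<rho> (1 - x) = conv W \<rho> x"
proof -
  have "W (1 - x - (1 - y)) = W (x - y)" for y using W_even[of "x - y"] by simp
  then show ?thesis
    using integral_reflect[of "\<lambda>y. W (1 - x - y)"] by (simp add: conv_def)
qed

lemma excess_reflect: "excess (1 - x) = excess x" by (simp add: excess_def conv_W_reflect)

lemma V'_reflect: "V' (1 - x) = - V' x"
proof -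
  have "W' (1 - x - (1 - y)) = - W' (x - y)" for y using W'_odd[of "x - y"] by simp
  then show ?thesis
    using integral_reflect[of "\<lambda>y. W' (1 - x - y)"] by (simp add: V'_def)
qed

section \<open>Scaling laws inside the unit interval\<close>

text \<open>
  All scaling laws are of this form: pointwise in \<open>y \<in> [0, 1]\<close> the two forces differ by an affine function of \<open>y\<close>,
  and the mean of the measure is \<open>1/2\<close>.
\<close>

lemma expectation_affine:
  assumes [measurable]: "f \<in> borel_measurable borel" "g \<in> borel_measurable borel"
    and B: "\<And>y. 0 \<le> y \<Longrightarrow> y \<le> 1 \<Longrightarrow> \<bar>f y\<bar> \<le> B"
    and eq: "\<And>y. 0 \<le> y \<Longrightarrow> y \<le> 1 \<Longrightarrow> g y = f y + (c + d * y)"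
  shows "expectation g = expectation f + c + d / 2"
proof -
  have "integrable \<rho> f" using B by (intro integrable_bounded_on_unit) auto
  moreover have "integrable \<rho> (\<lambda>y. y)" by (rule integrable_bounded_on_unit[where B=1]) auto
  moreover have "expectation g = expectation (\<lambda>y. f y + (c + d * y))"
    using eq by (intro integral_cong_unit) auto
  ultimately show ?thesis
    using integral_id prob_space by (simp add: space_eq_univ)
qed

text \<open>
  The profile \<open>\<omega>\<close> and the sign do not change, and \<open>2 * a * (1 - 1 / M) = 1 + 2 * b\<close> is the change of the linear part.
\<close>

lemma W'_scale:
  assumes "\<bar>t\<bar> \<le> M - \<alpha>"
  shows "W' (t / M) = W' t - (1 + 2 * b) * t"
proof -
  have pos: "W' (s / M) = W' s - (1 + 2 * b) * s" if "0 < s" "s \<le> M - \<alpha>" for s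
  proof -
    have "W' (s / M) = 2 * (a * (s / M)) - a + omega_lim M \<alpha> s"
      using omega_lim_scale[OF that] that M_gt_70 by (simp add: W'_pos right_diff_distrib)
    moreover have "W' s = (s + 4 * (b * s)) - a + omega_lim M \<alpha> s"
      using that by (simp add: W'_pos a_eq algebra_simps)
    ultimately show ?thesis unfolding a_times_divide by (simp add: algebra_simps)
  qed
  show ?thesis
  proof (cases t "0 :: real" rule: linorder_cases)
    case less
    then show ?thesis using pos[of "- t"] W'_odd[of t] W'_odd[of "t / M"] assms by simp
  qed (use pos assms W'_0 in auto)
qed

text \<open>
  In the coordinate \<open>q = M * (1 - t)\<close>, \<open>\<omega>\<close> runs backwards through its outermost layer: it is \<open>1/2 - q\<close> up to
  \<open>q = 2\<close>, where the slope turns to \<open>\<epsilon>\<close>, hence the kink of size \<open>1 + \<epsilon>\<close>.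
\<close>

lemma W'_near_one:
  assumes "- 2 \<le> q" "q \<le> \<alpha>"
  shows "W' (1 - q / M) = 1 + 2 * b - 2 * b * q - max 0 q + (1 + \<epsilon>) * max 0 (q - 2)"
proof -
  have "q + 1 \<le> M" using assms \<alpha>_lt by simp
  then have t: "1 / M \<le> 1 - q / M" using M_gt_70 by (simp add: field_simps)
  moreover have "0 < 1 / M" using M_gt_70 by simp
  ultimately have pos: "0 < 1 - q / M" by linarith
  have Mt: "M * (1 - q / M) = M - q" using M_gt_70 by (simp add: field_simps)
  have aq: "a * (2 * (1 - q / M) - 1) = 1/2 + 2 * b - 2 * b * q"
  proof -
    have "a * (2 * (1 - q / M) - 1) = a - 2 * (a * (q / M))" by (simp add: algebra_simps)
    then show ?thesis unfolding a_times_divide by (simp add: a_eq)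
  qed
  consider "q \<le> 0" | "0 \<le> q" "q \<le> 2" | "2 \<le> q" by linarith
  then have "tent M \<alpha> (M - q) = max 0 q - (1 + \<epsilon>) * max 0 (q - 2)"
  proof cases
    case 3
    then show ?thesis using tent_rise[of "M - q"] assms \<epsilon>_mult by (simp add: algebra_simps)
  qed (auto simp: tent_eq_0 tent_fall)
  then show ?thesis
    unfolding W'_pos[OF pos] omega_lim_outer_layer[OF t] Mt aq by simp
qed

lemma minus_right_map: "x - (M - 1 + y) / M = - (1 - (1 + M * x - y) / M)"
  using M_gt_70 by (simp add: field_simps)

lemma V'_split: "2 * V' x = expectation (\<lambda>y. W' (x - y / M)) + expectation (\<lambda>y. W' (x - (M - 1 + y) / M))"
proof -
  have "V' x = (expectation (\<lambda>y. W' (x - y / M)) + expectation (\<lambda>y. W' (x - (M - 1 + y) / M))) / 2"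
    unfolding V'_def by (rule integral_self_similar[OF _ W'_bounded_on_unit(1)]) measurable
  then show ?thesis by simp
qed

text \<open>
  The contributions \<open>- (1 + 2 * b) * (z - 1/2)\<close> of the left half and \<open>(1 + 2 * b) * (z - 1/2)\<close> of the right
  half cancel; this is where the coefficient \<open>M / (2 * M - 4)\<close> of the potential matters.
\<close>

lemma V'_scale:
  assumes z: "0 \<le> z" "z \<le> 1"
  shows "V' (z / M) = V' z / 2"
proof -
  have left: "expectation (\<lambda>y. W' (z / M - y / M)) = V' z + (- (1 + 2 * b) * z) + (1 + 2 * b) / 2"
    unfolding V'_def
  proof (rule expectation_affine[where B="2 * \<bar>z\<bar> + 5"])
    fix y :: real assume y: "0 \<le> y" "y \<le> 1"
    have "W' ((z - y) / M) = W' (z - y) - (1 + 2 * b) * (z - y)"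
      using z y \<alpha>_lt \<alpha>_upper by (intro W'_scale) (auto simp: abs_le_iff)
    then show "W' (z / M - y / M) = W' (z - y) + (- (1 + 2 * b) * z + (1 + 2 * b) * y)"
      by (simp add: diff_divide_distrib algebra_simps)
  qed (auto simp: W'_bounded_on_unit)
  have right: "expectation (\<lambda>y. W' (z / M - (M - 1 + y) / M)) =
      expectation (\<lambda>_. 0) + ((1 + 2 * b) * z) + (- (1 + 2 * b)) / 2"
  proof (rule expectation_affine[where B=0])
    fix y :: real assume y: "0 \<le> y" "y \<le> 1"
    have "W' (1 - (1 + z - y) / M) = 1 + 2 * b - 2 * b * (1 + z - y) - (1 + z - y)"
      using z y \<alpha>_gt_24 by (subst W'_near_one) auto
    then show "W' (z / M - (M - 1 + y) / M) = 0 + ((1 + 2 * b) * z + (- (1 + 2 * b)) * y)"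
      using M_gt_70 unfolding minus_right_map W'_odd by (simp add: algebra_simps)
  qed auto
  show ?thesis using V'_split[of "z / M"] left right
    by (simp add: algebra_simps add_divide_distrib diff_divide_distrib)
qed

lemma excess_scale:
  assumes z: "0 \<le> z" "z \<le> 1"
  shows "excess (z / M) = excess z / (2 * M)"
proof -
  have "excess (z / M) - excess (0 / M) = excess z / (2 * M) - excess 0 / (2 * M)"
  proof (rule DERIV_eq_imp_increment_eq[OF z(1), where f'="\<lambda>x. V' x / (2 * M)"])
    fix x assume x: "0 \<le> x" "x \<le> z"
    have "((\<lambda>x. excess (x / M)) has_real_derivative V' (x / M) * (1 / M)) (at x)"
      by (rule DERIV_chain2[OF excess_has_derivative DERIV_cdivide[OF DERIV_ident]])
    then show "((\<lambda>x. excess (x / M)) has_real_derivative V' x / (2 * M)) (at x)"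
      using V'_scale[of x] x z by (simp add: mult.commute)
    show "((\<lambda>x. excess x / (2 * M)) has_real_derivative V' x / (2 * M)) (at x)"
      by (intro DERIV_cdivide excess_has_derivative)
  qed
  then show ?thesis by (simp add: excess_0)
qed

lemma excess_1: "excess 1 = 0" using excess_reflect[of 0] excess_0 by simp

section \<open>The force outside and in the central gap\<close>

text \<open>
  The mean length by which the translate of the measure by \<open>z\<close> protrudes beyond \<open>1\<close>, where the affine branch of
  \<open>\<omega>\<close> ends.
\<close>

definition overlap :: "real \<Rightarrow> real" where "overlap z = expectation (\<lambda>y. max 0 (z + y - 1))"

lemma overlap_integrable: "integrable \<rho> (\<lambda>y. max 0 (z + y - 1))"
  by (rule integrable_bounded_on_unit[where B="\<bar>z\<bar>"]) auto

lemma overlap_nonneg: "0 \<le> overlap z"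
  unfolding overlap_def by (intro Bochner_Integration.integral_nonneg) auto

text \<open>
  For \<open>y, z \<in> [0, 1]\<close> one has \<open>z + y - 1 \<le> z * y\<close>, since \<open>(1 - z) * (1 - y) \<ge> 0\<close>.
\<close>

lemma overlap_le:
  assumes "0 \<le> z" "z \<le> 1"
  shows "overlap z \<le> z / 2"
proof -
  have "overlap z \<le> expectation (\<lambda>y. z * y)" unfolding overlap_def
  proof (rule integral_mono_AE[OF overlap_integrable])
    show "integrable \<rho> (\<lambda>y. z * y)"
      by (rule integrable_bounded_on_unit[where B="\<bar>z\<bar>"]) (auto simp: abs_mult intro: mult_left_le)
    show "AE y in \<rho>. max 0 (z + y - 1) \<le> z * y" using AE_unit
    proof eventually_elim
      case (elim y)
      have "0 \<le> (1 - z) * (1 - y)" using elim assms by (intro mult_nonneg_nonneg) auto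
      moreover have "0 \<le> z * y" using elim assms by (intro mult_nonneg_nonneg) auto
      ultimately show ?case by (simp add: algebra_simps)
    qed
  qed
  then show ?thesis using integral_id by simp
qed

lemma overlap_scale:
  assumes z: "0 \<le> z" "z \<le> 1"
  shows "overlap (z / M) = overlap z / (2 * M)"
proof -
  have zM: "z / M + 1 / M \<le> 1" "z / M \<le> 1" using z M_gt_70 by (simp_all add: field_simps)
  have "overlap (z / M) = (expectation (\<lambda>y. max 0 (z / M + y / M - 1))
      + expectation (\<lambda>y. max 0 (z / M + (M - 1 + y) / M - 1))) / 2"
    unfolding overlap_def using zM z by (intro integral_self_similar[where B=1]) auto
  moreover have "expectation (\<lambda>y. max 0 (z / M + y / M - 1)) = expectation (\<lambda>_. 0)"
  proof (rule integral_cong_unit)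
    fix y :: real assume "0 \<le> y" "y \<le> 1"
    then have "y / M \<le> 1 / M" using M_gt_70 by (intro divide_right_mono) auto
    then show "max 0 (z / M + y / M - 1) = 0" using zM by simp
  qed auto
  moreover have "max 0 (z / M + (M - 1 + y) / M - 1) = max 0 (z + y - 1) / M" for y
  proof -
    have "z / M + (M - 1 + y) / M - 1 = (z + y - 1) / M" using M_gt_70 by (simp add: field_simps)
    then show ?thesis using M_gt_70 by (simp add: max_def field_simps)
  qed
  ultimately show ?thesis by (simp add: overlap_def)
qed

text \<open>
  \<open>outer z\<close> is \<open>-V'(-z)\<close>, the slope of the potential in the outward direction at the point \<open>-z\<close>.
\<close>

definition outer :: "real \<Rightarrow> real" where "outer z = expectation (\<lambda>y. W' (z + y))"

lemma V'_minus: "V' (- z) = - outer z"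
proof -
  have "W' (- z - y) = - W' (z + y)" for y using W'_odd[of "z + y"] by simp
  then show ?thesis by (simp add: V'_def outer_def)
qed

lemma expectation_W'_scaled:
  assumes z: "0 \<le> z" "z \<le> 1"
  shows "expectation (\<lambda>y. W' (z / M + y / M)) = outer z + (- (1 + 2 * b) * z) + (- (1 + 2 * b)) / 2"
  unfolding outer_def
proof (rule expectation_affine[where B="2 * \<bar>z\<bar> + 5"])
  fix y :: real assume y: "0 \<le> y" "y \<le> 1"
  have "W' ((z + y) / M) = W' (z + y) - (1 + 2 * b) * (z + y)"
    using z y \<alpha>_lt \<alpha>_upper by (intro W'_scale) (auto simp: abs_le_iff)
  then show "W' (z / M + y / M) = W' (z + y) + (- (1 + 2 * b) * z + (- (1 + 2 * b)) * y)"
    by (simp add: add_divide_distrib algebra_simps)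
qed (auto simp: W'_bounded_on_unit)

text \<open>
  As in \<open>V'_scale\<close>, but the right half of the measure now reaches points beyond \<open>1\<close>, where \<open>\<omega>\<close> stays at
  \<open>1/2\<close> instead of continuing with slope \<open>M\<close>; the overlap is the difference.
\<close>

lemma outer_scale:
  assumes z: "0 \<le> z" "z \<le> 1"
  shows "outer (z / M) = (outer z - overlap z) / 2"
proof -
  have split: "outer (z / M) = (expectation (\<lambda>y. W' (z / M + y / M))
      + expectation (\<lambda>y. W' (z / M + (M - 1 + y) / M))) / 2"
    unfolding outer_def by (rule integral_self_similar[OF _ W'_bounded_on_unit(2)]) measurable
  have right: "expectation (\<lambda>y. W' (z / M + (M - 1 + y) / M)) =
      expectation (\<lambda>y. - max 0 (z + y - 1)) + (1 + 2 * b) * z + (1 + 2 * b) / 2"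
  proof (rule expectation_affine[where B=1])
    fix y :: real assume y: "0 \<le> y" "y \<le> 1"
    have "z / M + (M - 1 + y) / M = 1 - (1 - z - y) / M" using M_gt_70 by (simp add: field_simps)
    moreover have "W' (1 - (1 - z - y) / M) = 1 + 2 * b - 2 * b * (1 - z - y) - max 0 (1 - z - y)"
      using z y \<alpha>_gt_24 by (subst W'_near_one) auto
    moreover have "max 0 (1 - z - y) = (1 - z - y) + max 0 (z + y - 1)" by simp
    ultimately show "W' (z / M + (M - 1 + y) / M) =
        - max 0 (z + y - 1) + ((1 + 2 * b) * z + (1 + 2 * b) * y)"
      by (simp only:) (simp add: algebra_simps)
  qed (use z in auto)
  show ?thesis
    unfolding split expectation_W'_scaled[OF z] right using overlap_integrable[of z]
    by (simp add: overlap_def algebra_simps add_divide_distrib diff_divide_distrib)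
qed

text \<open>
  The computation is done at the mirror point \<open>1 - (1 + z) / M\<close>.  There the right half of the measure acts,
  up to scale, like the whole measure on the point \<open>-z\<close>, and the left half is at the distances \<open>1 - q / M\<close> with
  \<open>q = 1 + z + y\<close>, which pass the kink \<open>q = 2\<close> of \<open>W'_near_one\<close> exactly by the overlap.
\<close>

lemma V'_gap_left:
  assumes z: "0 \<le> z" "z \<le> 1"
  shows "V' ((1 + z) / M) = (outer z - (1 + \<epsilon>) * overlap z) / 2"
proof -
  let ?x = "1 - (1 + z) / M"
  have left: "expectation (\<lambda>y. W' (?x - y / M)) =
      expectation (\<lambda>y. (1 + \<epsilon>) * max 0 (z + y - 1)) + (- (1 + 2 * b) * z) + (- (1 + 2 * b)) / 2"
  proof (rule expectation_affine[where B="1 + \<epsilon>"])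
    fix y :: real assume y: "0 \<le> y" "y \<le> 1"
    have "?x - y / M = 1 - (1 + z + y) / M" by (simp add: add_divide_distrib)
    moreover have "W' (1 - (1 + z + y) / M) =
        1 + 2 * b - 2 * b * (1 + z + y) - (1 + z + y) + (1 + \<epsilon>) * max 0 (z + y - 1)"
      using z y \<alpha>_gt_24 by (subst W'_near_one) auto
    ultimately show "W' (?x - y / M) =
        (1 + \<epsilon>) * max 0 (z + y - 1) + (- (1 + 2 * b) * z + (- (1 + 2 * b)) * y)"
      by (simp only:) (simp add: algebra_simps)
    show "\<bar>(1 + \<epsilon>) * max 0 (z + y - 1)\<bar> \<le> 1 + \<epsilon>"
      unfolding abs_mult using z y \<epsilon>_pos by (intro order_trans[OF mult_left_le]) auto
  qed auto
  have "?x - (M - 1 + y) / M = - (z / M + y / M)" for y using M_gt_70 by (simp add: field_simps)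
  then have right: "expectation (\<lambda>y. W' (?x - (M - 1 + y) / M)) = - expectation (\<lambda>y. W' (z / M + y / M))"
    by (simp only: W'_odd Bochner_Integration.integral_minus)
  have "expectation (\<lambda>y. (1 + \<epsilon>) * max 0 (z + y - 1)) = (1 + \<epsilon>) * overlap z"
    by (simp add: overlap_def)
  then have "2 * V' ?x = (1 + \<epsilon>) * overlap z - outer z"
    unfolding V'_split left right expectation_W'_scaled[OF z] by simp
  then show ?thesis using V'_reflect[of "(1 + z) / M"] by simp
qed

lemma outer_eq:
  assumes "0 < z"
  shows "outer z = 2 * a * z + expectation (\<lambda>y. omega_lim M \<alpha> (z + y))"
proof -
  have "outer z = expectation (\<lambda>y. omega_lim M \<alpha> (z + y)) + (2 * a * z - a) + 2 * a / 2"
    unfolding outer_def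
  proof (rule expectation_affine[where B="3/2"])
    fix y :: real assume y: "0 \<le> y" "y \<le> 1"
    then show "W' (z + y) = omega_lim M \<alpha> (z + y) + (2 * a * z - a + 2 * a * y)"
      using W'_pos[of "z + y"] assms by (simp add: algebra_simps)
  qed (auto simp: omega_lim_abs_le[simplified])
  then show ?thesis by simp
qed

lemma expectation_omega_ge:
  assumes [measurable]: "f \<in> borel_measurable borel"
    and "\<And>y. 0 \<le> y \<Longrightarrow> y \<le> 1 \<Longrightarrow> c \<le> omega_lim M \<alpha> (f y)"
  shows "c \<le> expectation (\<lambda>y. omega_lim M \<alpha> (f y))"
proof -
  have "expectation (\<lambda>_. c) \<le> expectation (\<lambda>y. omega_lim M \<alpha> (f y))"
  proof (rule integral_mono_AE)
    show "integrable \<rho> (\<lambda>y. omega_lim M \<alpha> (f y))"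
      by (rule integrable_bounded_on_unit[where B="3/2"]) (auto simp: omega_lim_abs_le[simplified])
    show "AE y in \<rho>. c \<le> omega_lim M \<alpha> (f y)"
      using AE_unit by eventually_elim (simp add: assms(2))
  qed simp
  then show ?thesis using prob_space by simp
qed

text \<open>
  The quadratic part of the potential contributes \<open>2 * a * z \<ge> z\<close>.
\<close>

lemma outer_ge:
  assumes "0 < z" "c \<le> expectation (\<lambda>y. omega_lim M \<alpha> (z + y))"
  shows "z + c \<le> outer z"
proof -
  define w where "w = 2 * a * z"
  have "1 * z \<le> w" unfolding w_def using assms a_bounds by (intro mult_right_mono) auto
  then show ?thesis using outer_eq[of z] assms unfolding w_def[symmetric] by simp
qed

lemma outer_ge_trivial: "0 < z \<Longrightarrow> z - 3/2 \<le> outer z"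
  using outer_ge[of z "-3/2"] expectation_omega_ge[of "\<lambda>y. z + y" "-3/2"] omega_lim_bounds(1)
  by auto

lemma outer_ge_outside:
  assumes "1 \<le> z"
  shows "1 \<le> outer z"
proof -
  have "1/2 \<le> expectation (\<lambda>y. omega_lim M \<alpha> (z + y))"
    using assms omega_lim_outer by (intro expectation_omega_ge) auto
  then show ?thesis using outer_ge[of z "1/2"] assms by simp
qed

text \<open>
  Seen from \<open>-z\<close>, at distance at least \<open>1 / M\<close> from the unit interval, the right half of the measure lies beyond \<open>1\<close> and
  contributes the plateau value.
\<close>

lemma expectation_omega_split:
  assumes "1 / M \<le> z"
    and "\<And>y. 0 \<le> y \<Longrightarrow> y \<le> 1 \<Longrightarrow> c \<le> omega_lim M \<alpha> (z + y / M)"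
  shows "c / 2 + 1/4 \<le> expectation (\<lambda>y. omega_lim M \<alpha> (z + y))"
proof -
  have "expectation (\<lambda>y. omega_lim M \<alpha> (z + y)) = (expectation (\<lambda>y. omega_lim M \<alpha> (z + y / M))
      + expectation (\<lambda>y. omega_lim M \<alpha> (z + (M - 1 + y) / M))) / 2"
    by (rule integral_self_similar[where B="3/2"]) (auto simp: omega_lim_abs_le[simplified])
  moreover have "c \<le> expectation (\<lambda>y. omega_lim M \<alpha> (z + y / M))"
    using assms(2) by (intro expectation_omega_ge) auto
  moreover have "1/2 \<le> expectation (\<lambda>y. omega_lim M \<alpha> (z + (M - 1 + y) / M))"
  proof (rule expectation_omega_ge)
    fix y :: real assume y: "0 \<le> y" "y \<le> 1"
    have "1 / M + (M - 1 + y) / M = 1 + y / M" using M_gt_70 by (simp add: field_simps)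
    moreover have "0 \<le> y / M" using y M_gt_70 by simp
    ultimately have "1 \<le> z + (M - 1 + y) / M" using assms(1) by linarith
    then show "1/2 \<le> omega_lim M \<alpha> (z + (M - 1 + y) / M)" using omega_lim_outer by simp
  qed measurable
  ultimately show ?thesis by simp
qed

lemma outer_ge_middle:
  assumes "1 / M \<le> z"
  shows "z - 1/2 \<le> outer z"
proof -
  have "0 < 1 / M" using M_gt_70 by simp
  then have z: "0 < z" using assms by linarith
  have "(- 3/2) / 2 + 1/4 \<le> expectation (\<lambda>y. omega_lim M \<alpha> (z + y))"
  proof (rule expectation_omega_split[OF assms])
    fix y :: real assume "0 \<le> y" "y \<le> 1"
    then have "0 \<le> y / M" using M_gt_70 by simp
    then show "- 3/2 \<le> omega_lim M \<alpha> (z + y / M)" using z by (intro omega_lim_bounds(1)) auto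
  qed
  then show ?thesis using outer_ge[OF z, of "- 1/2"] by simp
qed

text \<open>
  The left half is also on the plateau, which by the upper bound on \<open>\<alpha>\<close> extends beyond \<open>3/5 + 1 / M\<close>.
\<close>

lemma outer_ge_plateau:
  assumes "1 / M \<le> z" "z \<le> 3/5"
  shows "z + 1/2 \<le> outer z"
proof -
  have "0 < 1 / M" using M_gt_70 by simp
  then have z: "0 < z" using assms by linarith
  have "(1/2) / 2 + 1/4 \<le> expectation (\<lambda>y. omega_lim M \<alpha> (z + y))"
  proof (rule expectation_omega_split[OF assms(1)])
    fix y :: real assume y: "0 \<le> y" "y \<le> 1"
    then have "0 \<le> y / M" using M_gt_70 by simp
    then have "1 / M \<le> z + y / M" using assms by linarith
    moreover have "M * z \<le> M * (3/5)" using assms M_gt_70 by (intro mult_left_mono) auto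
    then have "M * z + y \<le> M - \<alpha>" using y \<alpha>_le by linarith
    then have "M * (z + y / M) \<le> M - \<alpha>" using M_gt_70 by (simp add: distrib_left)
    ultimately show "1/2 \<le> omega_lim M \<alpha> (z + y / M)"
      by (simp add: omega_lim_outer_layer tent_eq_0)
  qed
  then show ?thesis using outer_ge[OF z, of "1/2"] by simp
qed

section \<open>Positivity of the margin\<close>

lemma excess_minus_has_derivative: "((\<lambda>z. excess (- z)) has_real_derivative outer z) (at z)"
  using DERIV_chain2[OF excess_has_derivative DERIV_minus[OF DERIV_ident], of z] V'_minus by simp

text \<open>
  The integral of \<open>overlap\<close> from \<open>0\<close> to \<open>z\<close>, written as the combination of values of the potential that has this
  derivative by \<open>outer_scale\<close>.
\<close>

definition overlap_int :: "real \<Rightarrow> real" where "overlap_int z = excess (- z) - 2 * M * excess (- (z / M))"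

lemma overlap_int_0: "overlap_int 0 = 0" by (simp add: overlap_int_def excess_0)

lemma overlap_int_has_derivative:
  assumes "0 \<le> z" "z \<le> 1"
  shows "(overlap_int has_real_derivative overlap z) (at z)"
proof -
  have "((\<lambda>z. excess (- (z / M))) has_real_derivative outer (z / M) * (1 / M)) (at z)"
    by (rule DERIV_chain2[OF excess_minus_has_derivative DERIV_cdivide[OF DERIV_ident]])
  then have "(overlap_int has_real_derivative outer z - 2 * M * (outer (z / M) * (1 / M))) (at z)"
    unfolding overlap_int_def by (intro DERIV_diff excess_minus_has_derivative DERIV_cmult)
  then show ?thesis using outer_scale[OF assms] M_gt_70 by simp
qed

lemma overlap_int_nonneg:
  assumes "0 \<le> z" "z \<le> 1"
  shows "0 \<le> overlap_int z"
proof -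
  have "0 - 0 \<le> overlap_int z - overlap_int 0"
    using assms
    by (intro DERIV_le_imp_increment_le[where f="\<lambda>_. 0" and f'="\<lambda>_. 0" and g'=overlap])
       (auto intro: overlap_int_has_derivative overlap_nonneg)
  then show ?thesis by (simp add: overlap_int_0)
qed

lemma overlap_int_le:
  assumes "0 \<le> z" "z \<le> 1"
  shows "overlap_int z \<le> z\<^sup>2 / 4"
proof -
  have "overlap_int z - overlap_int 0 \<le> z\<^sup>2 / 4 - 0\<^sup>2 / 4"
  proof (rule DERIV_le_imp_increment_le[OF assms(1)])
    fix x assume x: "0 \<le> x" "x \<le> z"
    show "(overlap_int has_real_derivative overlap x) (at x)" using x assms by (intro overlap_int_has_derivative) auto
    show "((\<lambda>x. x\<^sup>2 / 4) has_real_derivative x / 2) (at x)"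
      by (auto intro!: derivative_eq_intros)
    show "overlap x \<le> x / 2" using x assms by (intro overlap_le) auto
  qed
  then show ?thesis by (simp add: overlap_int_0)
qed

lemma overlap_int_scale:
  assumes "0 \<le> z" "z \<le> 1"
  shows "overlap_int (z / M) = overlap_int z / (2 * M\<^sup>2)"
proof -
  have "overlap_int (z / M) - overlap_int (0 / M) = overlap_int z / (2 * M\<^sup>2) - overlap_int 0 / (2 * M\<^sup>2)"
  proof (rule DERIV_eq_imp_increment_eq[OF assms(1)])
    fix x assume x: "0 \<le> x" "x \<le> z"
    have "0 \<le> x / M" "x / M \<le> 1" using x assms M_gt_70 by auto
    then have "((\<lambda>x. overlap_int (x / M)) has_real_derivative overlap (x / M) * (1 / M)) (at x)"
      by (intro DERIV_chain2[OF overlap_int_has_derivative DERIV_cdivide[OF DERIV_ident]]) auto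
    then show "((\<lambda>x. overlap_int (x / M)) has_real_derivative overlap x / (2 * M\<^sup>2)) (at x)"
      using overlap_scale[of x] x assms by (simp add: power2_eq_square mult.assoc)
    show "((\<lambda>x. overlap_int x / (2 * M\<^sup>2)) has_real_derivative overlap x / (2 * M\<^sup>2)) (at x)"
      using x assms by (intro DERIV_cdivide overlap_int_has_derivative) auto
  qed
  then show ?thesis by (simp add: overlap_int_0)
qed

text \<open>
  Up to the factor \<open>1 / (2 * M)\<close> this is the potential in the central gap at \<open>(1 + z) / M\<close>, by \<open>excess_gap_left\<close>.
\<close>

definition margin :: "real \<Rightarrow> real" where "margin z = excess (- z) - (1 + \<epsilon>) * overlap_int z"

lemma margin_0: "margin 0 = 0" by (simp add: margin_def excess_0 overlap_int_0)

lemma margin_has_derivative: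
  assumes "0 \<le> z" "z \<le> 1"
  shows "(margin has_real_derivative outer z - (1 + \<epsilon>) * overlap z) (at z)"
  unfolding margin_def
  by (intro DERIV_diff DERIV_cmult excess_minus_has_derivative overlap_int_has_derivative assms)

lemma excess_gap_left:
  assumes "0 \<le> z" "z \<le> 1"
  shows "excess ((1 + z) / M) = margin z / (2 * M)"
proof -
  have "excess ((1 + z) / M) - excess ((1 + 0) / M) = margin z / (2 * M) - margin 0 / (2 * M)"
  proof (rule DERIV_eq_imp_increment_eq[OF assms(1)])
    fix x assume x: "0 \<le> x" "x \<le> z"
    have "((\<lambda>x. (1 + x) / M) has_real_derivative 1 / M) (at x)"
      by (intro DERIV_cdivide) (auto intro!: derivative_eq_intros)
    from DERIV_chain2[OF excess_has_derivative this]
    show "((\<lambda>x. excess ((1 + x) / M)) has_real_derivative (outer x - (1 + \<epsilon>) * overlap x) / (2 * M)) (at x)"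
      using V'_gap_left[of x] x assms by simp
    show "((\<lambda>x. margin x / (2 * M)) has_real_derivative (outer x - (1 + \<epsilon>) * overlap x) / (2 * M)) (at x)"
      using x assms by (intro DERIV_cdivide margin_has_derivative) auto
  qed
  then show ?thesis using excess_scale[of 1] excess_1 margin_0 by simp
qed

lemma \<epsilon>_bounds: "2 / M \<le> \<epsilon>" "\<epsilon> \<le> 1 / 10"
  using \<alpha>_gt_24 \<alpha>_upper M_gt_70 by (simp_all add: \<epsilon>_def field_simps)

text \<open>
  The outward slope is at least \<open>- 3/2\<close> on \<open>[0, 1 / M]\<close>, \<open>1/2\<close> on \<open>[1 / M, 3/5]\<close> and \<open>1/10\<close> on \<open>[3/5, 1]\<close>.
\<close>

lemma excess_1_outer_ge: "3 / 10 \<le> excess (- 1)"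
proof -
  have M1: "0 < 1 / M" "1 / M < 1 / 70" using M_gt_70 by (simp_all add: field_simps)
  have incr: "excess (- y) - excess (- x) \<ge> c * (y - x)"
    if "x \<le> y" "\<And>z. x \<le> z \<Longrightarrow> z \<le> y \<Longrightarrow> c \<le> outer z" for c x y
  proof -
    have "c * y - c * x \<le> excess (- y) - excess (- x)"
      by (rule DERIV_le_imp_increment_le[OF that(1) _ excess_minus_has_derivative that(2)])
         (auto intro!: derivative_eq_intros)
    then show ?thesis by (simp add: right_diff_distrib)
  qed
  have "outer 0 = 0" using V'_minus[of 0] V'_scale[of 0] by simp
  then have "- 3/2 \<le> outer z" if "0 \<le> z" for z
    using outer_ge_trivial[of z] that by (cases "z = 0") auto
  then have 1: "excess (- (1 / M)) - excess (- 0) \<ge> - 3/2 * (1 / M - 0)"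
    using M1 by (intro incr) auto
  have 2: "excess (- (3/5)) - excess (- (1 / M)) \<ge> 1/2 * (3/5 - 1 / M)"
  proof (rule incr)
    fix z assume "1 / M \<le> z" "z \<le> 3/5"
    then show "1/2 \<le> outer z" using outer_ge_plateau[of z] M1 by linarith
  next
    show "1 / M \<le> 3/5" using M1 by linarith
  qed
  have 3: "excess (- 1) - excess (- (3/5)) \<ge> 1/10 * (1 - 3/5)"
  proof (rule incr)
    fix z :: real assume "3/5 \<le> z" "z \<le> 1"
    then show "1/10 \<le> outer z" using outer_ge_middle[of z] M1 by linarith
  qed auto
  show ?thesis using 1 2 3 M1 excess_0 by (simp only: right_diff_distrib minus_zero)
qed

text \<open>
  The starting value at \<open>1 / M\<close> comes from the values at \<open>1\<close> by scaling, where \<open>excess (- 1) \<ge> 3/10\<close> beats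
  \<open>overlap_int 1 \<le> 1/4\<close>.  From there the margin grows with slope at least \<open>1/2\<close> up to \<open>3/5\<close> and then has
  slope at least \<open>- 1/2\<close> over a shorter distance.
\<close>

lemma margin_pos_top:
  assumes z: "1 / M \<le> z" "z \<le> 1"
  shows "0 < margin z"
proof -
  have M1: "0 < 1 / M" "1 / M < 1 / 70" using M_gt_70 by (simp_all add: field_simps)
  have incr: "margin y - margin x \<ge> c * (y - x)"
    if "0 \<le> x" "x \<le> y" "y \<le> 1" "\<And>z. x \<le> z \<Longrightarrow> z \<le> y \<Longrightarrow> c \<le> outer z - (1 + \<epsilon>) * overlap z" for c x y
  proof -
    have "c * y - c * x \<le> margin y - margin x"
    proof (rule DERIV_le_imp_increment_le[OF that(2) _ margin_has_derivative that(4)])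
      show "((*) c has_real_derivative c) (at t)" for t by (auto intro!: derivative_eq_intros)
    qed (use that in auto)
    then show ?thesis by (simp add: right_diff_distrib)
  qed
  have overlap_up: "(1 + \<epsilon>) * overlap x \<le> 3/5 * x" if "0 \<le> x" "x \<le> 1" for x
  proof -
    have "(1 + \<epsilon>) * overlap x \<le> (6/5) * (x / 2)"
      using \<epsilon>_bounds \<epsilon>_pos overlap_le[OF that] overlap_nonneg that by (intro mult_mono) auto
    then show ?thesis by simp
  qed
  have start: "0 < margin (1 / M)"
  proof -
    have "overlap_int 1 \<le> 1/4" using overlap_int_le[of 1] by simp
    moreover have "2 * M * excess (- (1 / M)) = excess (- 1) - overlap_int 1" by (simp add: overlap_int_def)
    ultimately have "1/20 \<le> 2 * M * excess (- (1 / M))" using excess_1_outer_ge by simp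
    moreover have "2 * M * ((1 + \<epsilon>) * overlap_int (1 / M)) \<le> 1/50"
    proof -
      have "overlap_int (1 / M) = overlap_int 1 / (2 * M\<^sup>2)" using overlap_int_scale[of 1] by simp
      then have "2 * M * ((1 + \<epsilon>) * overlap_int (1 / M)) = (1 + \<epsilon>) * overlap_int 1 * (1 / M)"
        using M_gt_70 by (simp add: power2_eq_square)
      also have "\<dots> \<le> (6/5) * (1/4) * (1/70)"
        using \<epsilon>_bounds \<epsilon>_pos \<open>overlap_int 1 \<le> 1/4\<close> overlap_int_nonneg[of 1] M1 by (intro mult_mono mult_nonneg_nonneg) auto
      finally show ?thesis by simp
    qed
    ultimately have "0 < 2 * M * margin (1 / M)" unfolding margin_def by (simp only: right_diff_distrib)
    then show ?thesis using M_gt_70 by (simp add: zero_less_mult_iff)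
  qed
  have plateau: "1/2 \<le> outer x - (1 + \<epsilon>) * overlap x" if "1 / M \<le> x" "x \<le> 3/5" for x
    using outer_ge_plateau[of x] overlap_up[of x] that M1 by linarith
  show ?thesis
  proof (cases "z \<le> 3/5")
    case True
    have "1/2 * (z - 1 / M) \<le> margin z - margin (1 / M)"
      using z True M1 by (intro incr plateau) linarith+
    then show ?thesis using start z by simp
  next
    case False
    have 1: "1/2 * (3/5 - 1 / M) \<le> margin (3/5) - margin (1 / M)"
      using M1 by (intro incr plateau) linarith+
    have 2: "- 1/2 * (z - 3/5) \<le> margin z - margin (3/5)"
    proof (rule incr)
      fix x assume x: "3/5 \<le> x" "x \<le> z"
      then show "- 1/2 \<le> outer x - (1 + \<epsilon>) * overlap x"
        using outer_ge_middle[of x] overlap_up[of x] z M1 by linarith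
    qed (use False z in auto)
    show ?thesis using 1 2 start z M1 by (simp only: right_diff_distrib)
  qed
qed

text \<open>
  The scaling loses \<open>(1 + (1 + \<epsilon>) / M) * overlap_int z\<close> where the margin allows \<open>(1 + \<epsilon>) * overlap_int z\<close>; this
  suffices because \<open>\<epsilon> \<ge> 2 / M\<close>.
\<close>

lemma margin_scale_ge:
  assumes "0 \<le> z" "z \<le> 1"
  shows "margin z / (2 * M) \<le> margin (z / M)"
proof -
  have "2 * M * excess (- (z / M)) = excess (- z) - overlap_int z" by (simp add: overlap_int_def)
  moreover have "2 * M * ((1 + \<epsilon>) * overlap_int (z / M)) = (1 + \<epsilon>) / M * overlap_int z"
    using overlap_int_scale[OF assms] M_gt_70 by (simp add: power2_eq_square)
  moreover have "(1 + \<epsilon>) / M * overlap_int z \<le> \<epsilon> * overlap_int z"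
  proof (rule mult_right_mono)
    have "(1 + \<epsilon>) / M \<le> 2 / M" using \<epsilon>_bounds M_gt_70 by (intro divide_right_mono) auto
    then show "(1 + \<epsilon>) / M \<le> \<epsilon>" using \<epsilon>_bounds by simp
  qed (rule overlap_int_nonneg[OF assms])
  ultimately have "margin z \<le> 2 * M * margin (z / M)" unfolding margin_def by (simp add: algebra_simps)
  then show ?thesis using M_gt_70 by (simp add: field_simps)
qed

lemma margin_pos:
  assumes "0 < z" "z \<le> 1"
  shows "0 < margin z"
proof -
  have "0 < margin z" if "1 / M ^ k \<le> z" "z \<le> 1" for k z
    using that
  proof (induction k arbitrary: z)
    case 0
    then show ?case using margin_pos_top[of z] M_gt_70 by simp
  next
    case (Suc k)
    show ?case
    proof (cases "1 / M \<le> z")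
      case True
      then show ?thesis using margin_pos_top Suc.prems by simp
    next
      case False
      then have "M * z \<le> 1" using M_gt_70 by (simp add: field_simps)
      moreover have "1 / M ^ k \<le> M * z" using Suc.prems M_gt_70 by (simp add: field_simps)
      ultimately have "0 < margin (M * z)" by (intro Suc.IH)
      moreover have "0 \<le> M * z" using \<open>1 / M ^ k \<le> M * z\<close> M_gt_70
        by (intro order_trans[OF _ \<open>1 / M ^ k \<le> M * z\<close>]) auto
      then have "margin (M * z) / (2 * M) \<le> margin z"
        using margin_scale_ge[of "M * z"] \<open>M * z \<le> 1\<close> M_gt_70 by simp
      moreover have "0 < margin (M * z) / (2 * M)" using \<open>0 < margin (M * z)\<close> M_gt_70 by simp
      ultimately show ?thesis by linarith
    qed
  qed
  moreover obtain k where "1 / z < M ^ k" using real_arch_pow[of M "1 / z"] M_gt_70 by auto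
  then have "1 / M ^ k \<le> z" using assms M_gt_70 by (simp add: field_simps)
  ultimately show ?thesis using assms by blast
qed

section \<open>Positivity off the Cantor set\<close>

lemma excess_pos_left:
  assumes "x < 0"
  shows "0 < excess x"
proof -
  have near: "0 < excess (- z)" if "0 < z" "z \<le> 1" for z
  proof -
    have "0 \<le> (1 + \<epsilon>) * overlap_int z" using overlap_int_nonneg[of z] that \<epsilon>_pos by (intro mult_nonneg_nonneg) auto
    then show ?thesis using margin_pos[OF that] by (simp add: margin_def)
  qed
  show ?thesis
  proof (cases "- x \<le> 1")
    case True
    then show ?thesis using near[of "- x"] assms by simp
  next
    case False
    have "0 - 0 \<le> excess (- (- x)) - excess (- 1)"
    proof (rule DERIV_le_imp_increment_le[where f="\<lambda>_. 0" and f'="\<lambda>_. 0", OF _ _ excess_minus_has_derivative])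
      show "0 \<le> outer z" if "1 \<le> z" for z using outer_ge_outside[OF that] by simp
    qed (use False in auto)
    then show ?thesis using near[of 1] by simp
  qed
qed

lemma excess_pos_right:
  assumes "1 < x"
  shows "0 < excess x"
  using excess_pos_left[of "1 - x"] excess_reflect[of x] assms by simp

text \<open>
  For \<open>x = r / M\<close> in the middle of the gap the left half of the measure is at plateau distance, and the right half is at
  the distances \<open>1 - (r + y) / M\<close>, where the dip is at least \<open>max 0 (\<epsilon> * (\<alpha> - r - y))\<close>.  Averaging the convex
  bound over \<open>y\<close>, whose mean is \<open>1/2\<close>, gives the maximum below.
\<close>

lemma V'_gap_middle:
  assumes r: "2 \<le> r" "r \<le> M / 2"
  shows "2 * b * r - a + \<epsilon> / 2 * max 0 (\<alpha> - 1/2 - r) \<le> V' (r / M)"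
proof -
  let ?x = "1 - r / M"
  define T where "T = expectation (\<lambda>y. tent M \<alpha> (M - (r + y)))"
  have [measurable]: "tent M \<alpha> \<in> borel_measurable borel" unfolding tent_def by measurable
  have tent_abs: "\<bar>tent M \<alpha> s\<bar> \<le> 2" for s using tent_nonneg[of s] tent_le_2[of s] by simp
  have M1: "0 < 1 / M" using M_gt_70 by simp
  have "expectation (\<lambda>y. W' (?x - y / M)) =
      expectation (\<lambda>y. - tent M \<alpha> (M - (r + y))) + (a - 2 * b * r + 1/2) + (- 2 * b) / 2"
  proof (rule expectation_affine[where B=2])
    fix y :: real assume y: "0 \<le> y" "y \<le> 1"
    have x: "?x - y / M = 1 - (r + y) / M" by (simp add: add_divide_distrib)
    have t: "1 / M \<le> 1 - (r + y) / M" using r y M_gt_70 by (simp add: field_simps)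
    then have pos: "0 < 1 - (r + y) / M" using M1 by linarith
    have Mt: "M * (1 - (r + y) / M) = M - (r + y)" using M_gt_70 by (simp add: field_simps)
    have "a * (2 * (1 - (r + y) / M) - 1) = a - 2 * (a * ((r + y) / M))" by (simp add: algebra_simps)
    then show "W' (?x - y / M) = - tent M \<alpha> (M - (r + y)) + (a - 2 * b * r + 1/2 + - 2 * b * y)"
      unfolding x W'_pos[OF pos] omega_lim_outer_layer[OF t] Mt a_times_divide by (simp add: algebra_simps)
  qed (use tent_abs in auto)
  then have left: "expectation (\<lambda>y. W' (?x - y / M)) = a - 2 * b * r - b + 1/2 - T"
    by (simp add: T_def)
  have "expectation (\<lambda>y. W' (?x - (M - 1 + y) / M)) =
      expectation (\<lambda>_. 0) + (a - 2 * b * r + 2 * b - 1/2) + (- 2 * b) / 2"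
  proof (rule expectation_affine[where B=0])
    fix y :: real assume y: "0 \<le> y" "y \<le> 1"
    let ?t = "(r + y - 1) / M"
    have x: "?x - (M - 1 + y) / M = - ?t" using M_gt_70 by (simp add: field_simps)
    have t: "1 / M \<le> ?t" using r y M_gt_70 by (intro divide_right_mono) auto
    then have pos: "0 < ?t" using M1 by linarith
    have "M * ?t \<le> M - \<alpha>" using r y \<alpha>_upper M_gt_70 by simp
    then have "omega_lim M \<alpha> ?t = 1/2" by (simp add: omega_lim_outer_layer[OF t] tent_eq_0)
    moreover have "a * (2 * ?t - 1) = 2 * (a * ?t) - a" by (simp add: algebra_simps)
    ultimately show "W' (?x - (M - 1 + y) / M) = 0 + (a - 2 * b * r + 2 * b - 1/2 + - 2 * b * y)"
      unfolding x W'_odd W'_pos[OF pos] a_times_divide by (simp add: algebra_simps)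
  qed auto
  then have right: "expectation (\<lambda>y. W' (?x - (M - 1 + y) / M)) = a - 2 * b * r + b - 1/2" by simp
  have T0: "0 \<le> T" unfolding T_def by (intro Bochner_Integration.integral_nonneg tent_nonneg)
  have "expectation (\<lambda>y. \<epsilon> * (\<alpha> - r) + - \<epsilon> * y) = expectation (\<lambda>_. 0) + \<epsilon> * (\<alpha> - r) + - \<epsilon> / 2"
    by (rule expectation_affine[where B=0]) auto
  moreover have "expectation (\<lambda>y. \<epsilon> * (\<alpha> - r) + - \<epsilon> * y) \<le> T" unfolding T_def
  proof (rule integral_mono_AE)
    show "AE y in \<rho>. \<epsilon> * (\<alpha> - r) + - \<epsilon> * y \<le> tent M \<alpha> (M - (r + y))"
      using AE_unit
    proof eventually_elim
      case (elim y)
      have "\<epsilon> * (\<alpha> - (r + y)) \<le> \<epsilon> * (\<alpha> - 2)" using elim r \<epsilon>_pos by (intro mult_left_mono) auto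
      then have "\<epsilon> * (\<alpha> - (r + y)) \<le> M - (M - (r + y))" using \<epsilon>_mult elim r by simp
      then show ?case unfolding tent_eq by (simp add: algebra_simps)
    qed
    show "integrable \<rho> (\<lambda>y. tent M \<alpha> (M - (r + y)))"
      using tent_abs by (intro integrable_bounded_on_unit) auto
    show "integrable \<rho> (\<lambda>y. \<epsilon> * (\<alpha> - r) + - \<epsilon> * y)"
    proof (rule integrable_bounded_on_unit)
      fix y :: real assume "0 \<le> y" "y \<le> 1"
      then have "\<epsilon> * y \<le> \<epsilon>" using \<epsilon>_pos by (intro mult_left_le) auto
      then have "\<bar>- \<epsilon> * y\<bar> \<le> \<epsilon>" using \<epsilon>_pos \<open>0 \<le> y\<close> by (simp add: abs_mult)
      then show "\<bar>\<epsilon> * (\<alpha> - r) + - \<epsilon> * y\<bar> \<le> \<bar>\<epsilon> * (\<alpha> - r)\<bar> + \<epsilon>"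
        by (rule order_trans[OF abs_triangle_ineq add_left_mono])
    qed measurable
  qed
  ultimately have "\<epsilon> * (\<alpha> - r) - \<epsilon> / 2 \<le> T" by simp
  then have T1: "\<epsilon> * (\<alpha> - 1/2 - r) \<le> T" by (simp add: algebra_simps)
  have "\<epsilon> * max 0 (\<alpha> - 1/2 - r) \<le> T" using T0 T1 by (simp add: max_def)
  moreover have "2 * V' ?x = 2 * a - 4 * b * r - T" unfolding V'_split left right by simp
  ultimately show ?thesis using V'_reflect[of "r / M"] by simp
qed

text \<open>
  Integrating \<open>V'_gap_middle\<close> from \<open>2\<close>: up to \<open>r0 = \<alpha> - 1/2\<close> the minorant is a quadratic with positive increments,
  afterwards it decreases, so its value at \<open>M / 2\<close> is decisive.  There the dip has contributed at
  least \<open>(\<alpha> - 3) / 2\<close> to \<open>M\<close> times the minorant and the quadratic part has cost at most \<open>(M - 4) / 8\<close>; the lower bound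
  on \<open>\<alpha>\<close> makes the difference positive.
\<close>

lemma excess_pos_middle:
  assumes r: "2 \<le> r" "r \<le> M / 2"
  shows "0 < excess (r / M)"
proof -
  define r0 where "r0 = \<alpha> - 1/2"
  have r0: "2 \<le> r0" "r0 \<le> M / 2" using \<alpha>_gt_24 \<alpha>_upper by (simp_all add: r0_def)
  have bM: "b * M = a" using b_eq M_gt_70 by (simp add: field_simps)
  have bM2: "2 * b * (M - 2) = 1" using bM a_eq by (simp add: algebra_simps)
  \<comment> \<open>an antiderivative of \<open>2 * b * t - a\<close>, and the one that includes the dip up to \<open>r0\<close>\<close>
  define q where "q t = b * (t - M / 2)\<^sup>2" for t
  define q' where "q' t = q t - \<epsilon> / 4 * (r0 - t)\<^sup>2" for t
  have MU: "((\<lambda>t. M * excess (t / M)) has_real_derivative V' (t / M)) (at t)" for t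
    using DERIV_cmult[OF DERIV_chain2[OF excess_has_derivative DERIV_cdivide[OF DERIV_ident]], of M M t] M_gt_70
    by simp
  have dq: "(q has_real_derivative 2 * b * t - a) (at t)" for t
    unfolding q_def by (auto intro!: derivative_eq_intros simp: bM[symmetric] algebra_simps)
  have dq': "(q' has_real_derivative 2 * b * t - a + \<epsilon> / 2 * (r0 - t)) (at t)" for t
    unfolding q'_def by (auto intro!: derivative_eq_intros dq simp: algebra_simps diff_divide_distrib)
  have rising: "q' t - q' 2 \<le> M * excess (t / M) - M * excess (2 / M)" if t: "2 \<le> t" "t \<le> r0" for t
  proof (rule DERIV_le_imp_increment_le[OF t(1) dq' MU])
    fix s assume s: "2 \<le> s" "s \<le> t"
    have "max 0 (\<alpha> - 1/2 - s) = r0 - s" using s t by (simp add: r0_def)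
    then show "2 * b * s - a + \<epsilon> / 2 * (r0 - s) \<le> V' (s / M)"
      using V'_gap_middle[of s] s t r0 by simp
  qed
  have start: "0 < M * excess (2 / M)"
    using excess_gap_left[of 1] margin_pos[of 1] M_gt_70 by simp
  have \<epsilon>4: "\<epsilon> / 4 * (\<alpha> - 2) = 1/2" using \<epsilon>_mult by simp
  show ?thesis
  proof (cases "r \<le> r0")
    case True
    have "q' r - q' 2 = (r - 2) * (b * (r + 2 - M) + \<epsilon> / 4 * (2 * r0 - 2 - r))"
      by (simp add: q'_def q_def power2_eq_square algebra_simps add_divide_distrib diff_divide_distrib)
    moreover have "0 \<le> b * (r + 2 - M) + \<epsilon> / 4 * (2 * r0 - 2 - r)"
    proof -
      \<comment> \<open>the factor decreases in \<open>r\<close>, so the worst case is \<open>r = r0\<close>\<close>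
      have "b \<le> \<epsilon> / 4" using \<alpha>_gt_24 \<alpha>_lt by (simp add: b_def \<epsilon>_def field_simps)
      then have "b * (r0 - r) \<le> \<epsilon> / 4 * (r0 - r)" using True by (intro mult_right_mono) auto
      moreover have "b * (r0 + 2 - M) + \<epsilon> / 4 * (r0 - 2) = b * r0 - \<epsilon> / 8"
        using bM2 \<epsilon>4 by (simp add: r0_def algebra_simps)
      moreover have "\<epsilon> / 8 \<le> b * r0"
      proof -
        have "b * (M / 4) \<le> b * r0" using b_pos \<alpha>_lower M_gt_70 by (intro mult_left_mono) (auto simp: r0_def)
        then show ?thesis using bM a_bounds \<epsilon>_bounds by simp
      qed
      ultimately show ?thesis by (simp add: algebra_simps add_divide_distrib diff_divide_distrib)
    qed
    ultimately have "0 \<le> q' r - q' 2" using r by (simp add: mult_nonneg_nonneg)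
    then have "0 < M * excess (r / M)" using rising[of r] r True start by linarith
    then show ?thesis using M_gt_70 by (simp add: zero_less_mult_iff)
  next
    case False
    have "q r - q r0 \<le> M * excess (r / M) - M * excess (r0 / M)"
    proof (rule DERIV_le_imp_increment_le[OF _ dq MU])
      fix s assume s: "r0 \<le> s" "s \<le> r"
      then show "2 * b * s - a \<le> V' (s / M)" using V'_gap_middle[of s] r r0 by (simp add: r0_def)
    qed (use False in auto)
    moreover have "0 \<le> q r" using b_pos by (simp add: q_def)
    moreover have "q' r0 = q r0" by (simp add: q'_def)
    moreover have "q' 2 \<le> 0"
    proof -
      have "q 2 \<le> (M - 4) / 8"
      proof -
        have "q 2 = 2 * b * (M - 4) * ((M - 4) / 8)" by (simp add: q_def power2_eq_square algebra_simps diff_divide_distrib)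
        also have "2 * b * (M - 4) \<le> 1" using bM2 b_pos by (simp add: algebra_simps)
        then have "2 * b * (M - 4) * ((M - 4) / 8) \<le> 1 * ((M - 4) / 8)"
          using M_gt_70 by (intro mult_right_mono) auto
        finally show ?thesis by simp
      qed
      moreover have "(\<alpha> - 3) / 2 \<le> \<epsilon> / 4 * (r0 - 2)\<^sup>2"
      proof -
        have "\<epsilon> / 4 * (r0 - 2)\<^sup>2 = \<epsilon> / 4 * (\<alpha> - 2) * (\<alpha> - 3) + \<epsilon> / 16"
          by (simp add: r0_def power2_eq_square algebra_simps add_divide_distrib diff_divide_distrib)
        then show ?thesis using \<epsilon>4 \<epsilon>_pos by simp
      qed
      ultimately show ?thesis using \<alpha>_lower M_gt_70 by (simp add: q'_def)
    qed
    ultimately have "0 < M * excess (r / M)" using rising[of r0] r0 start by linarith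
    then show ?thesis using M_gt_70 by (simp add: zero_less_mult_iff)
  qed
qed

lemma excess_pos_gap:
  assumes x: "1 / M < x" "x < 1 - 1 / M"
  shows "0 < excess x"
proof -
  have half: "0 < excess x" if x: "1 / M < x" "x \<le> 1/2" for x
  proof (cases "M * x \<le> 2")
    case True
    have z: "0 < M * x - 1" using x M_gt_70 by (simp add: field_simps)
    then have "excess ((1 + (M * x - 1)) / M) = margin (M * x - 1) / (2 * M)"
      using True by (intro excess_gap_left) auto
    moreover have "0 < margin (M * x - 1)" using z True by (intro margin_pos) auto
    ultimately show ?thesis using M_gt_70 by simp
  next
    case False
    then show ?thesis using excess_pos_middle[of "M * x"] x M_gt_70 by simp
  qed
  show ?thesis
  proof (cases "x \<le> 1/2")
    case False
    then have "0 < excess (1 - x)" using x by (intro half) auto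
    then show ?thesis by (simp add: excess_reflect)
  qed (use half x in simp)
qed

section \<open>The potential and the support\<close>

lemma right_map_eq_reflect: "(M - 1 + z) / M = 1 - (1 - z) / M"
  using M_gt_70 by (simp add: field_simps)

lemma excess_scale_right:
  assumes "0 \<le> z" "z \<le> 1"
  shows "excess ((M - 1 + z) / M) = excess z / (2 * M)"
  using excess_scale[of "1 - z"] assms by (simp add: right_map_eq_reflect excess_reflect)

lemma V'_scale_right:
  assumes "0 \<le> z" "z \<le> 1"
  shows "V' ((M - 1 + z) / M) = V' z / 2"
  using V'_scale[of "1 - z"] assms by (simp add: right_map_eq_reflect V'_reflect)

lemma V'_abs_le: "\<bar>V' x\<bar> \<le> 2 * \<bar>x\<bar> + 5"
proof -
  have "\<bar>V' x\<bar> \<le> expectation (\<lambda>y. \<bar>W' (x - y)\<bar>)"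
    unfolding V'_def by (rule integral_abs_bound)
  also have "\<dots> \<le> expectation (\<lambda>_. 2 * \<bar>x\<bar> + 5)"
  proof (rule integral_mono_AE)
    show "AE y in \<rho>. \<bar>W' (x - y)\<bar> \<le> 2 * \<bar>x\<bar> + 5"
      using AE_unit by eventually_elim (simp add: W'_bounded_on_unit)
  qed (use W'_integrable in auto)
  finally show ?thesis using prob_space by simp
qed

lemma excess_continuous: "isCont excess x"
  by (rule DERIV_isCont[OF excess_has_derivative])

lemma excess_bounded_on_unit: obtains B where "\<And>x. 0 \<le> x \<Longrightarrow> x \<le> 1 \<Longrightarrow> \<bar>excess x\<bar> \<le> B"
proof -
  have "continuous_on {0..1} excess"
    by (intro continuous_at_imp_continuous_on ballI excess_continuous)
  then have "bounded (excess ` {0..1})"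
    by (intro compact_imp_bounded compact_continuous_image) auto
  then obtain B where "\<forall>x\<in>{0..1}. \<bar>excess x\<bar> \<le> B" by (auto simp: bounded_iff)
  then show ?thesis using that[of B] by simp
qed

lemma unit_cases:
  assumes "0 \<le> x" "x \<le> 1" "\<not> (1 / M < x \<and> x < 1 - 1 / M)"
  obtains z where "0 \<le> z" "z \<le> 1" "x = z / M" | z where "0 \<le> z" "z \<le> 1" "x = (M - 1 + z) / M"
proof (cases "x \<le> 1 / M")
  case True
  then show ?thesis using that(1)[of "M * x"] assms M_gt_70 by (simp add: field_simps)
next
  case False
  then have "1 - 1 / M \<le> x" using assms by simp
  then have "M - 1 \<le> M * x" using M_gt_70 by (simp add: field_simps)
  moreover have "M * x \<le> M * 1" using assms M_gt_70 by (intro mult_left_mono) auto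
  ultimately show ?thesis using that(2)[of "M * x - (M - 1)"] M_gt_70 by simp
qed

text \<open>
  A lower bound on the unit interval improves by a factor under the scaling law, and off the two images of
  the interval the excess is positive; so every negative lower bound can be halved.
\<close>

lemma excess_nonneg: "0 \<le> excess x"
proof -
  obtain B where B: "\<And>x. 0 \<le> x \<Longrightarrow> x \<le> 1 \<Longrightarrow> \<bar>excess x\<bar> \<le> B" using excess_bounded_on_unit by blast
  have B0: "0 \<le> B" using B[of 0] excess_0 by simp
  have lower: "- B * (1/2) ^ k \<le> excess x" for k x
  proof (induction k arbitrary: x)
    case 0
    then show ?case using excess_pos_left[of x] excess_pos_right[of x] B[of x] B0 by fastforce
  next
    case (Suc k)
    have neg: "- B * (1/2) ^ Suc k \<le> 0" using B0 by simp
    have shrink: "- B * (1/2) ^ Suc k \<le> excess z / (2 * M)" for z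
    proof -
      have "- B * (1/2) ^ Suc k \<le> (- B * (1/2) ^ Suc k) / M"
        using mult_left_mono_neg[OF _ neg, of 1 M] M_gt_70 by (simp only: le_divide_eq) simp
      also have "\<dots> = (- B * (1/2) ^ k) / (2 * M)" by simp
      also have "\<dots> \<le> excess z / (2 * M)" using Suc[of z] M_gt_70 by (intro divide_right_mono) auto
      finally show ?thesis .
    qed
    show ?case
    proof (cases "x < 0 \<or> 1 < x \<or> (1 / M < x \<and> x < 1 - 1 / M)")
      case True
      then have "0 < excess x" using excess_pos_left excess_pos_right excess_pos_gap by blast
      then show ?thesis using neg by linarith
    next
      case False
      then have "0 \<le> x" "x \<le> 1" "\<not> (1 / M < x \<and> x < 1 - 1 / M)" by auto
      then show ?thesis
      proof (cases rule: unit_cases)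
        case (1 z)
        then show ?thesis using shrink[of z] excess_scale[of z] by simp
      next
        case (2 z)
        then show ?thesis using shrink[of z] excess_scale_right[of z] by simp
      qed
    qed
  qed
  have "(\<lambda>k. - B * (1/2) ^ k) \<longlonglongrightarrow> - B * 0"
    by (intro tendsto_mult tendsto_const LIMSEQ_power_zero) simp
  then have "- B * 0 \<le> excess x" using lower by (intro LIMSEQ_le_const2) auto
  then show ?thesis by simp
qed

text \<open>
  A point without positive excess is outside all gaps: it has a preimage of the same kind under one of the two maps, and
  following preimages \<open>k\<close> times places it in an interval of length \<open>1 / M ^ k\<close> that carries mass \<open>1 / 2 ^ k\<close>.
\<close>

lemma prob_cball_ge:
  assumes "excess x \<le> 0"
  shows "1 / 2 ^ k \<le> prob (cball x (1 / M ^ k))"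
  using assms
proof (induction k arbitrary: x)
  case 0
  then have "0 \<le> x" "x \<le> 1" using excess_pos_left[of x] excess_pos_right[of x] by force+
  then have "y \<in> cball x 1" if "y \<in> {0..1}" for y using that by (auto simp: dist_real_def)
  then have "AE y in \<rho>. y \<in> cball x 1" using AE_unit by (auto elim: eventually_mono)
  then have "prob (cball x 1) = 1" by (subst prob_eq_1) auto
  then show ?case by simp
next
  case (Suc k)
  have M0: "0 < M" using M_gt_70 by simp
  have sim: "prob (cball x (1 / M ^ Suc k)) = (prob {y. y / M \<in> cball x (1 / M ^ Suc k)}
      + prob {y. (M - 1 + y) / M \<in> cball x (1 / M ^ Suc k)}) / 2"
    by (intro prob_self_similar) simp
  have preimage: "{y. (c + y) / M \<in> cball ((c + z) / M) (1 / M ^ Suc k)} = cball z (1 / M ^ k)" for c z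
  proof -
    have "(c + z) / M - (c + y) / M = (z - y) / M" for y by (simp flip: diff_divide_distrib)
    moreover have "1 / M ^ Suc k = 1 / M ^ k / M" by simp
    moreover have "\<bar>(z - y) / M\<bar> = \<bar>z - y\<bar> / M" for y using M0 by (simp add: abs_divide)
    ultimately have "\<bar>(c + z) / M - (c + y) / M\<bar> \<le> 1 / M ^ Suc k \<longleftrightarrow> \<bar>z - y\<bar> \<le> 1 / M ^ k" for y
      using M0 by (simp only: divide_le_cancel) simp
    then show ?thesis by (simp only: set_eq_iff mem_Collect_eq mem_cball dist_real_def simp_thms)
  qed
  have half: "1 / 2 ^ Suc k \<le> prob (cball z (1 / M ^ k)) / 2" if "excess z \<le> 0" for z
    using Suc.IH[OF that] by simp
  have "0 \<le> x" "x \<le> 1" "\<not> (1 / M < x \<and> x < 1 - 1 / M)"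
    using Suc.prems excess_pos_left[of x] excess_pos_right[of x] excess_pos_gap[of x] by force+
  then show ?case
  proof (cases rule: unit_cases)
    case (1 z)
    then have "excess z \<le> 0" using excess_scale[of z] Suc.prems M0 by (simp add: divide_le_0_iff)
    note half[OF this]
    moreover have "{y. y / M \<in> cball x (1 / M ^ Suc k)} = cball z (1 / M ^ k)"
      using preimage[of 0 z] 1 by (simp only: add_0)
    ultimately show ?thesis
      using sim measure_nonneg[of \<rho> "{y. (M - 1 + y) / M \<in> cball x (1 / M ^ Suc k)}"]
      by (simp only: add_divide_distrib)
  next
    case (2 z)
    then have "excess z \<le> 0" using excess_scale_right[of z] Suc.prems M0 by (simp add: divide_le_0_iff)
    note half[OF this]
    moreover have "{y. (M - 1 + y) / M \<in> cball x (1 / M ^ Suc k)} = cball z (1 / M ^ k)"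
      using preimage[of "M - 1" z] 2 by simp
    ultimately show ?thesis
      using sim measure_nonneg[of \<rho> "{y. y / M \<in> cball x (1 / M ^ Suc k)}"]
      by (simp only: add_divide_distrib)
  qed
qed

lemma excess_pos_off_msupp:
  assumes "x \<notin> msupp \<rho>"
  shows "0 < excess x"
proof (rule ccontr)
  assume "\<not> 0 < excess x"
  then have U0: "excess x \<le> 0" by simp
  obtain S where S: "open S" "x \<in> S" "emeasure \<rho> S = 0"
    using assms by (auto simp: msupp_def not_gr_zero)
  then obtain e where e: "0 < e" "cball x e \<subseteq> S" using open_contains_cball by blast
  obtain k where "1 / e < M ^ k" using real_arch_pow[of M "1 / e"] M_gt_70 by auto
  then have "1 / M ^ k \<le> e" using e M_gt_70 by (simp add: field_simps)
  then have "cball x (1 / M ^ k) \<subseteq> S" using e by auto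
  then have "prob (cball x (1 / M ^ k)) \<le> prob S"
    using S by (intro finite_measure_mono) auto
  moreover have "prob S = 0" using S by (simp add: measure_def)
  moreover have "0 < 1 / (2 :: real) ^ k" by simp
  ultimately show False using prob_cball_ge[OF U0, of k] by linarith
qed

text \<open>
  If neither preimage were in the support, the images of two null neighbourhoods would intersect in a null
  neighbourhood of \<open>x\<close>.
\<close>

lemma msupp_preimage:
  assumes "x \<in> msupp \<rho>"
  obtains z where "z \<in> msupp \<rho>" "x = z / M" | z where "z \<in> msupp \<rho>" "x = (M - 1 + z) / M"
proof -
  have "M * x \<in> msupp \<rho> \<or> M * x - (M - 1) \<in> msupp \<rho>"
  proof (rule ccontr)
    assume "\<not> ?thesis"
    then obtain S T where S: "open S" "M * x \<in> S" "emeasure \<rho> S = 0"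
      and T: "open T" "M * x - (M - 1) \<in> T" "emeasure \<rho> T = 0"
      by (auto simp: msupp_def not_gr_zero)
    \<comment> \<open>each half of the measure, pulled back, sees \<open>N\<close> inside one of the null sets\<close>
    define N where "N = (\<lambda>t. M * t) -` S \<inter> (\<lambda>t. M * t - (M - 1)) -` T"
    have "open N" unfolding N_def using S T
      by (intro open_Int open_vimage) (auto intro!: continuous_intros)
    moreover have "x \<in> N" using S T by (simp add: N_def)
    ultimately have "0 < emeasure \<rho> N" using assms by (auto simp: msupp_def)
    have "prob {y. y / M \<in> N} \<le> prob S" "prob {y. (M - 1 + y) / M \<in> N} \<le> prob T"
      using S T M_gt_70 by (auto intro!: finite_measure_mono simp: N_def)
    moreover have "prob S = 0" "prob T = 0" using S T by (simp_all add: measure_def)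
    ultimately have "prob N \<le> 0"
      using prob_self_similar[of N] \<open>open N\<close> by simp
    then show False using \<open>0 < emeasure \<rho> N\<close> by (simp add: emeasure_eq_measure)
  qed
  then show ?thesis using that(1)[of "M * x"] that(2)[of "M * x - (M - 1)"] M_gt_70 by auto
qed

lemma msupp_unit:
  assumes "x \<in> msupp \<rho>"
  shows "0 \<le> x" "x \<le> 1"
proof -
  have "prob (- {0..1}) = 0" by (rule prob_outside_unit) auto
  then have "emeasure \<rho> (- {0..1}) = 0" by (simp add: emeasure_eq_measure)
  moreover have "open (- {0..1 :: real})" by (rule open_Compl) simp
  ultimately have "x \<notin> - {0..1}" using assms unfolding msupp_def by fastforce
  then show "0 \<le> x" "x \<le> 1" by auto
qed

text \<open>
  Iterating the contraction along preimages inside the support bounds \<open>f\<close> by \<open>B / 2 ^ k\<close> for every \<open>k\<close>.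
\<close>

lemma vanishes_on_msupp:
  fixes f :: "real \<Rightarrow> real"
  assumes B: "\<And>z. 0 \<le> z \<Longrightarrow> z \<le> 1 \<Longrightarrow> \<bar>f z\<bar> \<le> B"
    and left: "\<And>z. 0 \<le> z \<Longrightarrow> z \<le> 1 \<Longrightarrow> \<bar>f (z / M)\<bar> \<le> \<bar>f z\<bar> / 2"
    and right: "\<And>z. 0 \<le> z \<Longrightarrow> z \<le> 1 \<Longrightarrow> \<bar>f ((M - 1 + z) / M)\<bar> \<le> \<bar>f z\<bar> / 2"
    and x: "x \<in> msupp \<rho>"
  shows "f x = 0"
proof -
  have "\<bar>f x\<bar> \<le> B * (1/2) ^ k" if "x \<in> msupp \<rho>" for k x
    using that
  proof (induction k arbitrary: x)
    case 0
    then show ?case using B msupp_unit by simp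
  next
    case (Suc k)
    from Suc.prems show ?case
    proof (cases rule: msupp_preimage)
      case (1 z)
      then show ?thesis using Suc.IH[of z] left[of z] msupp_unit[of z] by simp
    next
      case (2 z)
      then show ?thesis using Suc.IH[of z] right[of z] msupp_unit[of z] by simp
    qed
  qed
  moreover have "(\<lambda>k. B * (1/2) ^ k) \<longlonglongrightarrow> B * 0"
    by (intro tendsto_mult tendsto_const LIMSEQ_power_zero) simp
  ultimately have "\<bar>f x\<bar> \<le> B * 0" using x by (intro LIMSEQ_le_const) auto
  then show ?thesis by simp
qed

lemma excess_zero_on_msupp:
  assumes x: "x \<in> msupp \<rho>"
  shows "excess x = 0"
proof -
  obtain B where B: "\<And>x. 0 \<le> x \<Longrightarrow> x \<le> 1 \<Longrightarrow> \<bar>excess x\<bar> \<le> B" using excess_bounded_on_unit by blast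
  have "\<bar>excess z / (2 * M)\<bar> \<le> \<bar>excess z\<bar> / 2" for z
  proof -
    have "\<bar>excess z\<bar> / (2 * M) \<le> \<bar>excess z\<bar> / 2" using M_gt_70 by (intro divide_left_mono) auto
    moreover have "\<bar>2 * M\<bar> = 2 * M" using M_gt_70 by simp
    ultimately show ?thesis by (simp only: abs_divide)
  qed
  then show ?thesis using excess_scale excess_scale_right
    by (intro vanishes_on_msupp[OF B _ _ x]) auto
qed

lemma V'_zero_on_msupp:
  assumes "x \<in> msupp \<rho>"
  shows "V' x = 0"
proof (rule vanishes_on_msupp[where B=7, OF _ _ _ assms])
  fix z :: real assume "0 \<le> z" "z \<le> 1"
  then show "\<bar>V' z\<bar> \<le> 7" using V'_abs_le[of z] by simp
qed (auto simp: V'_scale V'_scale_right)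

text \<open>
  By the scaling law the mean of the excess equals itself divided by \<open>2 * M\<close>, hence it is zero; and the excess is
  nonnegative.
\<close>

lemma AE_excess_zero: "AE x in \<rho>. excess x = 0"
proof -
  obtain B where B: "\<And>x. 0 \<le> x \<Longrightarrow> x \<le> 1 \<Longrightarrow> \<bar>excess x\<bar> \<le> B" using excess_bounded_on_unit by blast
  have [measurable]: "excess \<in> borel_measurable borel"
    by (intro borel_measurable_continuous_onI continuous_at_imp_continuous_on ballI excess_continuous)
  have "integrable \<rho> excess" using B by (intro integrable_bounded_on_unit) auto
  have "expectation excess = (expectation (\<lambda>y. excess (y / M)) + expectation (\<lambda>y. excess ((M - 1 + y) / M))) / 2"
    by (rule integral_self_similar[OF _ B]) auto
  moreover have "expectation (\<lambda>y. excess (y / M)) = expectation (\<lambda>y. excess y / (2 * M))"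
    by (rule integral_cong_unit) (auto simp: excess_scale)
  moreover have "expectation (\<lambda>y. excess ((M - 1 + y) / M)) = expectation (\<lambda>y. excess y / (2 * M))"
    by (rule integral_cong_unit) (auto simp: excess_scale_right)
  ultimately have "expectation excess = expectation excess / (2 * M)" by simp
  then have "expectation excess = 0" using M_gt_70 by (simp add: field_simps)
  then show ?thesis using \<open>integrable \<rho> excess\<close> excess_nonneg
    by (simp add: integral_nonneg_eq_0_iff_AE)
qed

section \<open>Hoelder continuity of the derivative\<close>

text \<open>
  The Hausdorff dimension of the Cantor set, the solution of \<open>M powr d = 2\<close>.
\<close>

definition hdim :: real where "hdim = ln 2 / ln M"

lemma hdim_bounds: "0 < hdim" "hdim \<le> 1"
  using M_gt_70 by (simp_all add: hdim_def)

lemma M_powr_hdim: "(M ^ j) powr hdim = 2 ^ j"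
proof -
  have "M powr hdim = 2" using M_gt_70 by (simp add: hdim_def powr_def)
  then have "(M powr real j) powr hdim = 2 powr real j" by (metis powr_powr_swap)
  then show ?thesis using M_gt_70 by (simp add: powr_realpow)
qed

lemma prob_cball_powr:
  assumes "0 < r"
  shows "prob (cball x r) \<le> 2 * r powr hdim"
proof (cases "r \<le> 1")
  case False
  then have "1 \<le> r powr hdim" using hdim_bounds by (simp add: ge_one_powr_ge_zero)
  then show ?thesis using prob_le_1[of "cball x r"] by linarith
next
  case True
  obtain j where j: "1 \<le> j" "1 / M ^ j < r" "r \<le> M / M ^ j"
    using layer_exists[of M r] assms True M_gt_70 by auto
  then obtain i where i: "j = Suc i" by (cases j) auto
  have "r \<le> 1 / M ^ i" using j i M_gt_70 by simp
  then have "cball x r \<subseteq> cball x (1 / M ^ i)" by auto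
  then have "prob (cball x r) \<le> prob (cball x (1 / M ^ i))"
    by (intro finite_measure_mono) auto
  also have "\<dots> \<le> 1 / 2 ^ i" by (rule prob_cball_le)
  also have "\<dots> = 2 * (1 / M ^ j) powr hdim"
    using M_gt_70 M_powr_hdim[of j] by (simp add: powr_divide i)
  also have "\<dots> \<le> 2 * r powr hdim"
    using j hdim_bounds M_gt_70 by (intro mult_left_mono powr_mono2) auto
  finally show ?thesis .
qed

text \<open>
  The hypotheses put \<open>t\<close> and \<open>t'\<close> on the same side of \<open>0\<close> at distance at least \<open>\<delta>\<close>, where \<open>omega_lim_diff_le\<close>
  applies.
\<close>

lemma W'_diff_le_far:
  assumes "0 < \<delta>" "2 * \<delta> \<le> \<bar>t\<bar>" "\<bar>t - t'\<bar> \<le> \<delta>"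
  shows "\<bar>W' t - W' t'\<bar> \<le> (2 + M / \<delta>) * \<bar>t - t'\<bar>"
proof -
  have \<epsilon>1: "\<epsilon> \<le> 1" using \<epsilon>_bounds by simp
  have ordered: "\<bar>W' s - W' s'\<bar> \<le> (2 + M / \<delta>) * (s' - s)" if s: "\<delta> \<le> s" "s \<le> s'" for s s'
  proof -
    have "W' s - W' s' = - (2 * a * (s' - s)) + (omega_lim M \<alpha> s - omega_lim M \<alpha> s')"
      using s assms by (simp add: W'_pos algebra_simps)
    then have "\<bar>W' s - W' s'\<bar> \<le> \<bar>- (2 * a * (s' - s))\<bar> + \<bar>omega_lim M \<alpha> s - omega_lim M \<alpha> s'\<bar>"
      using abs_triangle_ineq by metis
    also have "\<dots> \<le> 2 * (s' - s) + M / \<delta> * (s' - s)"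
    proof (rule add_mono)
      have "2 * a * (s' - s) \<le> 2 * (s' - s)" using s a_bounds by (intro mult_right_mono) auto
      then show "\<bar>- (2 * a * (s' - s))\<bar> \<le> 2 * (s' - s)" using s a_bounds by (simp add: abs_mult)
      show "\<bar>omega_lim M \<alpha> s - omega_lim M \<alpha> s'\<bar> \<le> M / \<delta> * (s' - s)"
        using s assms by (intro omega_lim_diff_le[OF \<epsilon>1]) auto
    qed
    finally show ?thesis by (simp add: distrib_right)
  qed
  have pos: "\<bar>W' s - W' s'\<bar> \<le> (2 + M / \<delta>) * \<bar>s - s'\<bar>" if "\<delta> \<le> s" "\<delta> \<le> s'" for s s'
  proof (cases "s \<le> s'")
    case True
    then show ?thesis using ordered[of s s'] that by simp
  next
    case False
    then show ?thesis using ordered[of s' s] that by (simp add: abs_minus_commute)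
  qed
  show ?thesis
  proof (cases "0 \<le> t")
    case True
    have "\<delta> \<le> t'" using True assms by (simp add: abs_le_iff)
    then show ?thesis using pos[of t t'] True assms by simp
  next
    case False
    have "\<delta> \<le> - t'" using False assms by (simp add: abs_le_iff)
    then have "\<bar>W' (- t) - W' (- t')\<bar> \<le> (2 + M / \<delta>) * \<bar>- t - (- t')\<bar>"
      using pos[of "- t" "- t'"] False assms by simp
    then show ?thesis by (simp add: W'_odd abs_minus_commute)
  qed
qed

lemma W'_diff_le: "\<bar>W' t - W' t'\<bar> \<le> 2 * \<bar>t - t'\<bar> + 5"
proof -
  define w where "w s = omega_lim M \<alpha> s - a * sgn s" for s
  have w: "\<bar>w s\<bar> \<le> 5/2" for s
  proof -
    have "\<bar>a * sgn s\<bar> \<le> 1" using a_bounds by (auto simp: abs_mult sgn_real_def)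
    then show ?thesis
      using abs_triangle_ineq4[of "omega_lim M \<alpha> s" "a * sgn s"] omega_lim_abs_le[of s]
      unfolding w_def by linarith
  qed
  have "W' t - W' t' = 2 * a * (t - t') + (w t - w t')"
    by (simp add: W'_def w_def algebra_simps)
  then have "\<bar>W' t - W' t'\<bar> \<le> \<bar>2 * a * (t - t')\<bar> + \<bar>w t - w t'\<bar>"
    using abs_triangle_ineq by metis
  also have "\<dots> \<le> 2 * \<bar>t - t'\<bar> + 5"
  proof (rule add_mono)
    show "\<bar>2 * a * (t - t')\<bar> \<le> 2 * \<bar>t - t'\<bar>"
      unfolding abs_mult using a_bounds by (intro mult_right_mono) auto
    show "\<bar>w t - w t'\<bar> \<le> 5"
      using abs_triangle_ineq4[of "w t" "w t'"] w[of t] w[of t'] by linarith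
  qed
  finally show ?thesis .
qed

text \<open>
  The near part \<open>\<bar>x - y\<bar> < 2 * \<delta>\<close> is paid for by the measure of a ball, the far part by the Lipschitz constant.
\<close>

lemma V'_diff_le:
  assumes "0 < \<delta>" "\<bar>x - x'\<bar> \<le> \<delta>"
  shows "\<bar>V' x - V' x'\<bar> \<le> (2 + M / \<delta>) * \<bar>x - x'\<bar> + 5 * prob (cball x (2 * \<delta>))"
proof -
  let ?h = "\<bar>x - x'\<bar>"
  let ?g = "\<lambda>y. (2 + M / \<delta>) * ?h + 5 * indicator (cball x (2 * \<delta>)) y"
  have ind: "integrable \<rho> (\<lambda>y. 5 * indicator (cball x (2 * \<delta>)) y :: real)"
    by (intro integrable_mult_right integrable_real_indicator) (auto simp: emeasure_eq_measure)
  have "\<bar>V' x - V' x'\<bar> = \<bar>expectation (\<lambda>y. W' (x - y) - W' (x' - y))\<bar>"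
    unfolding V'_def by (simp add: W'_integrable)
  also have "\<dots> \<le> expectation (\<lambda>y. \<bar>W' (x - y) - W' (x' - y)\<bar>)" by (rule integral_abs_bound)
  also have "\<dots> \<le> expectation ?g"
  proof (rule integral_mono)
    fix y
    show "\<bar>W' (x - y) - W' (x' - y)\<bar> \<le> ?g y"
    proof (cases "2 * \<delta> \<le> \<bar>x - y\<bar>")
      case True
      then have "\<bar>W' (x - y) - W' (x' - y)\<bar> \<le> (2 + M / \<delta>) * ?h"
        using W'_diff_le_far[of \<delta> "x - y" "x' - y"] assms by simp
      then show ?thesis by (rule order_trans) simp
    next
      case False
      have "2 * ?h \<le> (2 + M / \<delta>) * ?h" using assms M_gt_70 by (intro mult_right_mono) auto
      moreover have "y \<in> cball x (2 * \<delta>)" using False by (simp add: dist_real_def)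
      ultimately show ?thesis using W'_diff_le[of "x - y" "x' - y"] by simp
    qed
    show "integrable \<rho> ?g"
      by (intro Bochner_Integration.integrable_add ind) simp
  qed (use W'_integrable in auto)
  also have "expectation ?g = (2 + M / \<delta>) * ?h + 5 * prob (cball x (2 * \<delta>))"
    using ind prob_space by (subst Bochner_Integration.integral_add) auto
  finally show ?thesis .
qed

text \<open>
  The cut-off \<open>\<delta> = sqrt \<bar>x - x'\<bar>\<close>: the far part is then of order \<open>\<delta>\<close>, the near part of order \<open>\<delta> powr hdim\<close>.
\<close>

lemma V'_holder_near:
  assumes h: "0 < \<bar>x - x'\<bar>" "\<bar>x - x'\<bar> \<le> 1"
  shows "\<bar>V' x - V' x'\<bar> \<le> (M + 22) * \<bar>x - x'\<bar> powr (hdim / 2)"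
proof -
  let ?h = "\<bar>x - x'\<bar>"
  let ?\<delta> = "?h powr (1/2)"
  have \<delta>: "0 < ?\<delta>" using h by simp
  have small: "?h powr e \<le> ?h powr (hdim / 2)" if "hdim / 2 \<le> e" for e
    using h that by (intro powr_mono') auto
  have h_eq: "?h = ?h powr 1" using h by simp
  have 1: "?h \<le> ?h powr (hdim / 2)" using small[of 1] hdim_bounds h_eq by simp
  have "?\<delta> * ?\<delta> = ?h" using h by (simp flip: powr_add)
  then have quot: "?h / ?\<delta> = ?\<delta>" using \<delta> by (simp add: divide_eq_eq)
  have "M / ?\<delta> * ?h = M * (?h / ?\<delta>)" by simp
  also have "\<dots> \<le> M * ?h powr (hdim / 2)"
    unfolding quot using small[of "1/2"] hdim_bounds M_gt_70 by (intro mult_left_mono) auto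
  finally have 2: "M / ?\<delta> * ?h \<le> M * ?h powr (hdim / 2)" .
  have "prob (cball x (2 * ?\<delta>)) \<le> 2 * (2 * ?\<delta>) powr hdim"
    using \<delta> by (intro prob_cball_powr) simp
  also have "\<dots> = 2 * (2 powr hdim * ?h powr (hdim / 2))"
    by (simp add: powr_mult powr_powr)
  also have "\<dots> \<le> 2 * (2 * ?h powr (hdim / 2))"
    using powr_mono[of hdim 1 2] hdim_bounds by (intro mult_left_mono mult_right_mono) auto
  finally have 3: "prob (cball x (2 * ?\<delta>)) \<le> 4 * ?h powr (hdim / 2)" by simp
  have "?h \<le> ?\<delta>" using h powr_mono'[of "1/2" 1 ?h] by simp
  then have "\<bar>V' x - V' x'\<bar> \<le> (2 + M / ?\<delta>) * ?h + 5 * prob (cball x (2 * ?\<delta>))"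
    using \<delta> by (intro V'_diff_le) auto
  also have "\<dots> = 2 * ?h + M / ?\<delta> * ?h + 5 * prob (cball x (2 * ?\<delta>))"
    by (simp only: distrib_right)
  also have "\<dots> \<le> 2 * ?h powr (hdim / 2) + M * ?h powr (hdim / 2) + 5 * (4 * ?h powr (hdim / 2))"
    using 1 2 3 by (intro add_mono mult_left_mono) auto
  finally show ?thesis by (simp add: algebra_simps)
qed

lemma deriv_conv_W: "deriv (conv W \<rho>) x = V' x"
  by (rule DERIV_imp_deriv) (rule conv_W_has_derivative)

lemma conv_W_C1_holder: "C1_holder_loc (hdim / 2) (conv W \<rho>)"
  unfolding C1_holder_loc_def deriv_conv_W
proof (intro conjI allI impI)
  show "conv W \<rho> field_differentiable (at x)" for x
    using conv_W_has_derivative field_differentiable_def by blast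
  fix K :: "real set" assume "compact K"
  then obtain R where R: "\<And>x. x \<in> K \<Longrightarrow> \<bar>x\<bar> \<le> R"
    using compact_imp_bounded by (force simp: bounded_iff)
  define C where "C = (M + 22) + 2 * (2 * \<bar>R\<bar> + 5)"
  have "\<bar>V' x - V' x'\<bar> \<le> C * \<bar>x - x'\<bar> powr (hdim / 2)" if x: "x \<in> K" "x' \<in> K" for x x'
  proof -
    consider "x = x'" | "0 < \<bar>x - x'\<bar>" "\<bar>x - x'\<bar> \<le> 1" | "1 < \<bar>x - x'\<bar>" by fastforce
    then show ?thesis
    proof cases
      case 2
      have "(M + 22) * \<bar>x - x'\<bar> powr (hdim / 2) \<le> C * \<bar>x - x'\<bar> powr (hdim / 2)"
        by (intro mult_right_mono) (auto simp: C_def)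
      then show ?thesis using V'_holder_near[OF 2] by linarith
    next
      case 3
      have "\<bar>V' x - V' x'\<bar> \<le> \<bar>V' x\<bar> + \<bar>V' x'\<bar>" by (rule abs_triangle_ineq4)
      also have "\<dots> \<le> (2 * \<bar>R\<bar> + 5) + (2 * \<bar>R\<bar> + 5)"
        using V'_abs_le[of x] V'_abs_le[of x'] R[OF x(1)] R[OF x(2)] by (intro add_mono) auto
      also have "\<dots> \<le> C * 1" using M_gt_70 by (simp add: C_def)
      also have "\<dots> \<le> C * \<bar>x - x'\<bar> powr (hdim / 2)"
        using 3 hdim_bounds M_gt_70 by (intro mult_left_mono ge_one_powr_ge_zero) (auto simp: C_def)
      finally show ?thesis .
    qed simp
  qed
  then show "\<exists>C. \<forall>x\<in>K. \<forall>y\<in>K. \<bar>V' x - V' y\<bar> \<le> C * \<bar>x - y\<bar> powr (hdim / 2)" by blast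
qed

text \<open>
  Almost every point is a global minimum of the potential, hence has \<open>0\<close> in its subdifferential.
\<close>

lemma steady_state_W: "steady_state W \<rho>"
  unfolding steady_state_def
  using AE_excess_zero
proof eventually_elim
  case (elim x)
  then have "conv W \<rho> x \<le> conv W \<rho> y" for y using excess_nonneg[of y] by (simp add: excess_def)
  then have "conv W \<rho> x + 0 * (y - x) - e * \<bar>y - x\<bar> \<le> conv W \<rho> y" if "0 < e" for e y
    using that mult_nonneg_nonneg[of e "\<bar>y - x\<bar>"] by (simp add: add_increasing2 diff_le_eq)
  then show ?case by (auto simp: subdifferential_def)
qed

end

theorem theorem9p6:
  fixes M \<alpha> :: real and W :: "real \<Rightarrow> real" and \<rho> :: "real measure"
  assumes "1/3 * (M + 2) < \<alpha>" and "\<alpha> \<le> 2/5 * (M - 10)"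
    and "is_limit_potential M \<alpha> W"
    and "is_cantor_measure M \<rho>"
  shows "(\<forall>x. integrable \<rho> (\<lambda>y. W (x - y)))
    \<and> (\<exists>c. (\<forall>x\<in>msupp \<rho>. conv W \<rho> x = c) \<and> (\<forall>x. x \<notin> msupp \<rho> \<longrightarrow> conv W \<rho> x > c))
    \<and> (\<exists>\<gamma>. 0 < \<gamma> \<and> \<gamma> \<le> 1 \<and> C1_holder_loc \<gamma> (conv W \<rho>))
    \<and> (\<forall>x. (AE y in \<rho>. W field_differentiable (at (x - y)))
           \<and> integrable \<rho> (\<lambda>y. deriv W (x - y))
           \<and> (conv W \<rho> has_real_derivative conv (deriv W) \<rho> x) (at x))
    \<and> (\<forall>x\<in>msupp \<rho>. conv (deriv W) \<rho> x = 0)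
    \<and> steady_state W \<rho>"
proof -
  interpret cantor_energy M \<alpha> W \<rho> using assms by unfold_locales
  have "\<exists>c. (\<forall>x\<in>msupp \<rho>. conv W \<rho> x = c) \<and> (\<forall>x. x \<notin> msupp \<rho> \<longrightarrow> conv W \<rho> x > c)"
    using excess_zero_on_msupp excess_pos_off_msupp
    by (intro exI[of _ "conv W \<rho> 0"]) (auto simp: excess_def)
  moreover have "\<exists>\<gamma>. 0 < \<gamma> \<and> \<gamma> \<le> 1 \<and> C1_holder_loc \<gamma> (conv W \<rho>)"
    using conv_W_C1_holder hdim_bounds by (intro exI[of _ "hdim / 2"]) auto
  moreover have "AE y in \<rho>. W field_differentiable (at (x - y))" for x
    using AE_neq[of x]
  proof eventually_elim
    case (elim y)
    then show ?case
      using W_has_derivative[of "x - y"] by (auto simp: field_differentiable_def)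
  qed
  ultimately show ?thesis
    using W_integrable deriv_W_integrable conv_W_has_derivative V'_zero_on_msupp steady_state_W
    by (simp add: conv_deriv_W)
qed

end
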